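(* For every finite rooted tree $T$, $\operatorname{dcw}(T)=\operatorname{dcw}(S(T))$, where $S(T)$ is the standard serialization of $T$. Consequently, the directed cutwidth of a tree can be computed in polynomial time.
   Context: A tree $T=\langle V,E\rangle$ is a finite rooted tree whose directed edges $E$ point from parents to children (towards the leaves). A serialization of $T$ is a word $S\in V^*$ containing each vertex $v\in V$ exactly once, at position $v_S\in\{1,\ldots,|V|\}$, such that $\langle v,w\rangle\in E$ implies $v_S<w_S$. For $i\in\{1,\ldots,|V|-1\}$, $\operatorname{cut}(i)=|\{\langle v,w\rangle\in E\mid v_S\le i<w_S\}|$. The cutwidth of $S$ is $\operatorname{dcw}(S)=\max_{1\le i<|V|}\operatorname{cut}(i)$ (taken to be $0$ if $|V|=1$), and the directed cutwidth $\operatorname{dcw}(T)$ is the minimum of $\operatorname{dcw}(S)$ over all serializations $S$ of $T$. The standard serialization $S(T)$ is defined inductively: if $V=\{v\}$ then $S(T)=v$; if $|V|>1$, let $r$ be the root of $T$ and $C_1,\ldots,C_\ell$ its direct child subtrees (subtrees rooted at the children of $r$), ordered so that $i<j$ implies $\operatorname{dcw}(S(C_i))\le\operatorname{dcw}(S(C_j))$; then $S(T)=r\,S(C_1)\cdots S(C_\ell)$. *)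

theory Defs
  imports "HOL-Computational_Algebra.Polynomial"
begin

section \<open>Rooted trees and their serializations\<close>

text \<open>A directed graph is given by its vertex set \<open>V\<close> and its set of directed edges \<open>E\<close>; edges of
  a tree point from parents to children.\<close>

definition rooted_at :: "'a set \<Rightarrow> ('a \<times> 'a) set \<Rightarrow> 'a \<Rightarrow> bool" where
  "rooted_at V E r \<longleftrightarrow>
     finite V \<and> E \<subseteq> V \<times> V \<and> r \<in> V \<and>
     (\<forall>u. (u, r) \<notin> E) \<and>
     (\<forall>v \<in> V - {r}. \<exists>!u. (u, v) \<in> E) \<and>
     (\<forall>v \<in> V. (r, v) \<in> E\<^sup>*)"

definition rooted_tree :: "'a set \<Rightarrow> ('a \<times> 'a) set \<Rightarrow> bool" where
  "rooted_tree V E \<longleftrightarrow> (\<exists>r. rooted_at V E r)"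

definition pos :: "'a list \<Rightarrow> 'a \<Rightarrow> nat" where
  "pos S v = (THE i. 1 \<le> i \<and> i \<le> length S \<and> S ! (i - 1) = v)"

definition serialization :: "'a set \<Rightarrow> ('a \<times> 'a) set \<Rightarrow> 'a list \<Rightarrow> bool" where
  "serialization V E S \<longleftrightarrow>
     distinct S \<and> set S = V \<and> (\<forall>(v, w) \<in> E. pos S v < pos S w)"

definition cut :: "('a \<times> 'a) set \<Rightarrow> 'a list \<Rightarrow> nat \<Rightarrow> nat" where
  "cut E S i = card {(v, w). (v, w) \<in> E \<and> pos S v \<le> i \<and> i < pos S w}"

definition dcw_ser :: "'a set \<Rightarrow> ('a \<times> 'a) set \<Rightarrow> 'a list \<Rightarrow> nat" where
  "dcw_ser V E S = (if card V = 1 then 0 else Max (cut E S ` {1..<card V}))"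

definition dcw :: "'a set \<Rightarrow> ('a \<times> 'a) set \<Rightarrow> nat" where
  "dcw V E = Min (dcw_ser V E ` {S. serialization V E S})"

definition sub_verts :: "('a \<times> 'a) set \<Rightarrow> 'a \<Rightarrow> 'a set" where
  "sub_verts E v = {w. (v, w) \<in> E\<^sup>*}"

definition sub_edges :: "('a \<times> 'a) set \<Rightarrow> 'a \<Rightarrow> ('a \<times> 'a) set" where
  "sub_edges E v = E \<inter> (sub_verts E v \<times> sub_verts E v)"

text \<open>The standard serialization is unique only up to the order of child subtrees of equal cutwidth,
  so it is a relation: \<open>standard_serialization V E S\<close> holds for every word \<open>S\<close> that arises from some
  admissible ordering of the child subtrees at each vertex. The list \<open>cs\<close> enumerates the children of
  the root \<open>r\<close>, and \<open>Ss\<close> the serializations chosen for the subtrees rooted at them.\<close>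

inductive standard_serialization :: "'a set \<Rightarrow> ('a \<times> 'a) set \<Rightarrow> 'a list \<Rightarrow> bool" where
  single: "standard_serialization {v} {} [v]"
| branch: "\<lbrakk> rooted_at V E r; 1 < card V;
     distinct cs; set cs = {c. (r, c) \<in> E};
     list_all2 (\<lambda>c S. standard_serialization (sub_verts E c) (sub_edges E c) S) cs Ss;
     sorted (map2 (\<lambda>c S. dcw_ser (sub_verts E c) (sub_edges E c) S) cs Ss) \<rbrakk>
   \<Longrightarrow> standard_serialization V E (r # concat Ss)"

section \<open>Polynomial-time computability\<close>

text \<open>The machine model is the language WHILE of N. D. Jones (Computability and Complexity from a
  Programming Perspective, MIT Press 1997): imperative programs over binary trees, with unit cost
  for each elementary operation. Its polynomial-time computable functions are those of
  Turing machines (cells are shared, so every elementary operation is a bounded number of pointer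
  operations). There is deliberately no equality test on whole trees.\<close>

datatype sexp = NIL | PAIR sexp sexp

primrec sexp_hd :: "sexp \<Rightarrow> sexp" where
  "sexp_hd NIL = NIL"
| "sexp_hd (PAIR a b) = a"

primrec sexp_tl :: "sexp \<Rightarrow> sexp" where
  "sexp_tl NIL = NIL"
| "sexp_tl (PAIR a b) = b"

type_synonym store = "nat \<Rightarrow> sexp"

datatype expr =
    Var nat
  | Const sexp
  | ECons expr expr
  | Hd expr
  | Tl expr

primrec eval_expr :: "expr \<Rightarrow> store \<Rightarrow> sexp" where
  "eval_expr (Var x) s = s x"
| "eval_expr (Const d) s = d"
| "eval_expr (ECons a b) s = PAIR (eval_expr a s) (eval_expr b s)"
| "eval_expr (Hd a) s = sexp_hd (eval_expr a s)"
| "eval_expr (Tl a) s = sexp_tl (eval_expr a s)"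

primrec expr_time :: "expr \<Rightarrow> nat" where
  "expr_time (Var x) = 1"
| "expr_time (Const d) = 1"
| "expr_time (ECons a b) = 1 + expr_time a + expr_time b"
| "expr_time (Hd a) = 1 + expr_time a"
| "expr_time (Tl a) = 1 + expr_time a"

datatype com =
    Skip
  | Assign nat expr
  | Seq com com
  | Cond expr com com
  | While expr com

text \<open>\<open>exec c s t s'\<close>: started in store \<open>s\<close>, command \<open>c\<close> halts in store \<open>s'\<close> after \<open>t\<close> steps. A test
  succeeds iff its value is not \<open>NIL\<close>.\<close>

inductive exec :: "com \<Rightarrow> store \<Rightarrow> nat \<Rightarrow> store \<Rightarrow> bool" where
  Skip: "exec Skip s 1 s"
| Assign: "exec (Assign x a) s (1 + expr_time a) (s(x := eval_expr a s))"
| Seq: "exec c s t s' \<Longrightarrow> exec c' s' t' s'' \<Longrightarrow> exec (Seq c c') s (1 + t + t') s''"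
| CondTrue: "eval_expr a s \<noteq> NIL \<Longrightarrow> exec c s t s' \<Longrightarrow>
    exec (Cond a c c') s (1 + expr_time a + t) s'"
| CondFalse: "eval_expr a s = NIL \<Longrightarrow> exec c' s t s' \<Longrightarrow>
    exec (Cond a c c') s (1 + expr_time a + t) s'"
| WhileFalse: "eval_expr a s = NIL \<Longrightarrow> exec (While a c) s (1 + expr_time a) s"
| WhileTrue: "eval_expr a s \<noteq> NIL \<Longrightarrow> exec c s t s' \<Longrightarrow> exec (While a c) s' t' s'' \<Longrightarrow>
    exec (While a c) s (1 + expr_time a + t + t') s''"

text \<open>Input and output are passed in variable \<open>0\<close>; all other variables are initially \<open>NIL\<close>.\<close>

definition computes_within :: "com \<Rightarrow> sexp \<Rightarrow> sexp \<Rightarrow> nat \<Rightarrow> bool" where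
  "computes_within c d e b \<longleftrightarrow>
     (\<exists>t s'. exec c ((\<lambda>_. NIL)(0 := d)) t s' \<and> s' 0 = e \<and> t \<le> b)"

text \<open>A function \<open>f\<close> on a set \<open>I\<close> of instances is computable in polynomial time w.r.t. an encoding
  \<open>enc\<close> of the instances and an encoding \<open>out\<close> of the results; \<open>size\<close> counts the pairs of a binary
  tree.\<close>

definition polytime_computable ::
    "'i set \<Rightarrow> ('i \<Rightarrow> sexp) \<Rightarrow> ('o \<Rightarrow> sexp) \<Rightarrow> ('i \<Rightarrow> 'o) \<Rightarrow> bool" where
  "polytime_computable I enc out f \<longleftrightarrow>
     (\<exists>(c :: com) (q :: nat poly). \<forall>x \<in> I.
        computes_within c (enc x) (out (f x)) (poly q (size (enc x))))"

text \<open>Input trees are presented by a list of vertices and a list of edges, in any order, where the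
  vertices are named by arbitrary binary words. The result is output in unary, which is harmless
  since \<open>dcw\<close> is less than the number of vertices.\<close>

type_synonym word = "bool list"

definition tree_instances :: "(word list \<times> (word \<times> word) list) set" where
  "tree_instances =
     {(vs, es). distinct vs \<and> distinct es \<and> rooted_tree (set vs) (set es)}"

definition enc_list :: "('a \<Rightarrow> sexp) \<Rightarrow> 'a list \<Rightarrow> sexp" where
  "enc_list f xs = foldr (\<lambda>x. PAIR (f x)) xs NIL"

definition enc_bool :: "bool \<Rightarrow> sexp" where
  "enc_bool b = (if b then PAIR NIL NIL else NIL)"

definition enc_word :: "word \<Rightarrow> sexp" where
  "enc_word = enc_list enc_bool"

definition enc_edge :: "word \<times> word \<Rightarrow> sexp" where
  "enc_edge e = PAIR (enc_word (fst e)) (enc_word (snd e))"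

definition enc_instance :: "word list \<times> (word \<times> word) list \<Rightarrow> sexp" where
  "enc_instance x = PAIR (enc_list enc_word (fst x)) (enc_list enc_edge (snd x))"

definition enc_unary :: "nat \<Rightarrow> sexp" where
  "enc_unary n = enc_list (\<lambda>_. NIL) (replicate n ())"

end

theory Submission
  imports Defs "HOL-Library.Multiset"
begin

text \<open>Let \<open>d\<^sub>1 \<le> \<dots> \<le> d\<^sub>l\<close> be the widths of the child subtrees of the root. Serializing the subtrees one
  after the other in this order gives the width \<open>max l (max\<^sub>i (d\<^sub>i + l - i))\<close>. No serialization does
  better: it cuts \<open>l\<close> edges after the root, and if \<open>d\<^sub>i > 0\<close>, then at the first moment at which one of
  the subtrees \<open>i, \<dots>, l\<close> has \<open>d\<^sub>i\<close> edges cut, the other \<open>l - i\<close> of them are unfinished and contribute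
  at least one edge each.

  The value is the result of folding \<open>m := max (m + 1) d\<^sub>i\<close> over the sorted widths. A program can
  therefore repeatedly remove a leaf of minimal value from the tree and fold its value into the
  parent. The values of the removed leaves never decrease, so each vertex meets the widths of its
  children in sorted order.\<close>

section \<open>Cuts as sets of edges leaving a prefix\<close>

text \<open>Cuts at positions become cuts of prefix sets because sets restrict to subtrees: the
  trace of a prefix on a child subtree is a prefix of the word restricted to it. Once the root is
  placed, a cut is the number of absent children plus the cuts inside the child subtrees.

  The obstacle in the lower bound is that a word may interleave the child subtrees, so it presents
  them in no order. Looking at the first moment of a large cut avoids untangling the word.

  The algorithm is shaped by the machine, which has no recursion, no arithmetic and no comparison of
  numbers. Removing leaves by value replaces both recursion and sorting; comparing a value with the
  level becomes the test whether a unary counter is at most 1. The removed values never decrease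
  because a subtree is at least as wide as each of its child subtrees.\<close>

definition prefix_cut :: "('a \<times> 'a) set \<Rightarrow> 'a set \<Rightarrow> nat" where
  "prefix_cut E P = card {(v, w). (v, w) \<in> E \<and> v \<in> P \<and> w \<notin> P}"

lemma pos_nth:
  assumes "distinct S" "i < length S"
  shows "pos S (S ! i) = Suc i"
  unfolding pos_def
proof (rule the_equality)
  fix j assume "1 \<le> j \<and> j \<le> length S \<and> S ! (j - 1) = S ! i"
  then have "j - 1 = i" using assms nth_eq_iff_index_eq[of S "j - 1" i] by auto
  then show "j = Suc i" using \<open>1 \<le> j \<and> _\<close> by auto
qed (use assms in auto)

lemma mem_take_iff_pos:
  assumes "distinct S" "v \<in> set S"
  shows "v \<in> set (take i S) \<longleftrightarrow> pos S v \<le> i"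
proof -
  obtain k where k: "k < length S" "v = S ! k" using assms(2) by (metis in_set_conv_nth)
  have "v \<in> set (take i S) \<longleftrightarrow> k < i"
  proof
    assume "v \<in> set (take i S)"
    then obtain j where "j < length S" "j < i" "S ! j = v"
      by (auto simp: in_set_conv_nth)
    then show "k < i" using k assms(1) nth_eq_iff_index_eq by metis
  next
    assume "k < i"
    then show "v \<in> set (take i S)" using k by (auto simp: in_set_conv_nth intro!: exI[of _ k])
  qed
  then show ?thesis using pos_nth[OF assms(1) k(1)] k(2) by auto
qed

lemma pos_inj:
  assumes "distinct S" "v \<in> set S" "w \<in> set S" "pos S v = pos S w"
  shows "v = w"
  using assms by (metis in_set_conv_nth pos_nth nat.inject)

lemma cut_eq_prefix_cut:
  assumes "distinct S" "E \<subseteq> set S \<times> set S"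
  shows "cut E S i = prefix_cut E (set (take i S))"
proof -
  have "{(v, w). (v, w) \<in> E \<and> pos S v \<le> i \<and> i < pos S w} =
      {(v, w). (v, w) \<in> E \<and> v \<in> set (take i S) \<and> w \<notin> set (take i S)}"
    using assms by (auto simp: mem_take_iff_pos subset_iff not_le)
  then show ?thesis by (simp add: cut_def prefix_cut_def)
qed

text \<open>The order condition becomes: every prefix is closed under parents. Loops are excluded
  because a loop is harmless for closure but violates the strict
  \<open>pos S v < pos S w\<close>.\<close>

lemma serialization_iff:
  assumes "E \<subseteq> V \<times> V" "\<And>v. (v, v) \<notin> E"
  shows "serialization V E S \<longleftrightarrow> distinct S \<and> set S = V \<and>
    (\<forall>i v w. (v, w) \<in> E \<longrightarrow> w \<in> set (take i S) \<longrightarrow> v \<in> set (take i S))"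
proof (cases "distinct S \<and> set S = V")
  case True
  have "(\<forall>(v, w) \<in> E. pos S v < pos S w) \<longleftrightarrow>
    (\<forall>i v w. (v, w) \<in> E \<longrightarrow> w \<in> set (take i S) \<longrightarrow> v \<in> set (take i S))" (is "?L \<longleftrightarrow> ?R")
  proof
    assume ?L
    then show ?R using True assms(1) by (fastforce simp: mem_take_iff_pos)
  next
    assume R: ?R
    show ?L
    proof safe
      fix v w assume e: "(v, w) \<in> E"
      then have in_V: "v \<in> set S" "w \<in> set S" using assms(1) True by auto
      have "w \<in> set (take (pos S w) S)" using in_V True by (simp add: mem_take_iff_pos)
      then have "pos S v \<le> pos S w" using R e in_V True mem_take_iff_pos by metis
      moreover have "pos S v \<noteq> pos S w" using pos_inj in_V True assms(2) e by metis
      ultimately show "pos S v < pos S w" by simp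
    qed
  qed
  then show ?thesis by (simp add: serialization_def)
qed (auto simp: serialization_def)

text \<open>For \<open>i = 0\<close> and for \<open>i \<ge> card V\<close> no edge leaves the
  prefix, so the range of the maximum extends to all \<open>i\<close>. This also absorbs the
  one-vertex case, where the maximum would be over the empty set.\<close>

lemma dcw_ser_le_iff:
  assumes "distinct S" "set S = V" "V \<noteq> {}" "E \<subseteq> V \<times> V"
  shows "dcw_ser V E S \<le> X \<longleftrightarrow> (\<forall>i. prefix_cut E (set (take i S)) \<le> X)"
proof -
  have len: "length S = card V" using assms distinct_card[of S] by simp
  have zero: "prefix_cut E (set (take i S)) = 0" if "i = 0 \<or> card V \<le> i" for i
  proof (cases "i = 0")
    case False
    then have *: "set (take i S) = V" using that len assms by auto
    have "{(v, w). (v, w) \<in> E \<and> v \<in> V \<and> w \<notin> V} = {}" using assms(4) by blast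
    then show ?thesis unfolding * prefix_cut_def by (metis card.empty)
  qed (simp add: prefix_cut_def)
  have "dcw_ser V E S \<le> X \<longleftrightarrow> (\<forall>i \<in> {1..<card V}. prefix_cut E (set (take i S)) \<le> X)"
  proof (cases "card V = 1")
    case False
    have "finite V" using assms(2) by auto
    then have "card V > 1" using assms(3) False by (simp add: card_gt_0_iff nat_neq_iff)
    then show ?thesis using assms
      by (simp add: dcw_ser_def cut_eq_prefix_cut)
  qed (simp add: dcw_ser_def)
  also have "\<dots> \<longleftrightarrow> (\<forall>i. prefix_cut E (set (take i S)) \<le> X)"
  proof (intro iffI allI ballI)
    fix i assume "\<forall>i \<in> {1..<card V}. prefix_cut E (set (take i S)) \<le> X"
    then show "prefix_cut E (set (take i S)) \<le> X"
      using zero[of i] by (cases "i = 0 \<or> card V \<le> i") auto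
  qed simp
  finally show ?thesis .
qed

lemma prefix_cut_le_dcw_ser:
  assumes "distinct S" "set S = V" "V \<noteq> {}" "E \<subseteq> V \<times> V"
  shows "prefix_cut E (set (take i S)) \<le> dcw_ser V E S"
  using dcw_ser_le_iff[OF assms, of "dcw_ser V E S"] by simp

text \<open>Carries prefixes of a word restricted to a subtree back to prefixes of the whole word;
  both the order condition and the cuts of the restricted word are read off this way.\<close>

lemma take_filter_ex:
  "\<exists>j. take i (filter Q xs) = filter Q (take j xs)"
proof (induction xs arbitrary: i)
  case (Cons x xs)
  show ?case
  proof (cases "Q x")
    case True
    show ?thesis
    proof (cases i)
      case 0
      then show ?thesis by (auto intro: exI[of _ 0])
    next
      case (Suc n)
      obtain j where "take n (filter Q xs) = filter Q (take j xs)" using Cons.IH by blast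
      then show ?thesis using True Suc by (auto intro: exI[of _ "Suc j"])
    qed
  next
    case False
    obtain j where "take i (filter Q xs) = filter Q (take j xs)" using Cons.IH by blast
    then show ?thesis using False by (auto intro: exI[of _ "Suc j"])
  qed
qed simp

lemma finite_serializations:
  assumes "finite V"
  shows "finite {S. serialization V E S}"
  by (rule finite_subset[OF _ finite_subset_distinct[OF assms]]) (auto simp: serialization_def)

lemma dcw_le:
  assumes "finite V" "serialization V E S"
  shows "dcw V E \<le> dcw_ser V E S"
  unfolding dcw_def using assms by (auto intro!: Min_le simp: finite_serializations)

section \<open>Subtrees\<close>

lemma rooted_at_unique_parent:
  assumes "rooted_at V E r" "(u, v) \<in> E" "(u', v) \<in> E"
  shows "u = u'"
proof -
  have "v \<in> V - {r}" using assms by (auto simp: rooted_at_def)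
  then have "\<exists>!u. (u, v) \<in> E" using assms(1) by (simp add: rooted_at_def)
  then show ?thesis using assms(2,3) by blast
qed

text \<open>A cycle through \<open>v\<close> passes through the only parent of \<open>v\<close>, so
  it can be pushed up the path from the root until it would have to enter the root.\<close>

lemma rooted_at_acyclic:
  assumes "rooted_at V E r"
  shows "(v, v) \<notin> E\<^sup>+"
proof (cases "v \<in> V")
  case True
  then have "(r, v) \<in> E\<^sup>*" using assms by (auto simp: rooted_at_def)
  then show ?thesis
  proof (induction)
    case base
    show ?case using assms by (metis rooted_at_def tranclE)
  next
    case (step u v)
    show ?case
    proof
      assume "(v, v) \<in> E\<^sup>+"
      then obtain x where x: "(v, x) \<in> E\<^sup>*" "(x, v) \<in> E" by (meson tranclD2)
      have "x = u" using rooted_at_unique_parent[OF assms x(2) step(2)] .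
      then show False using x step by (meson rtrancl_into_trancl2)
    qed
  qed
next
  case False
  then show ?thesis using assms by (auto simp: rooted_at_def dest: tranclD)
qed

lemma rooted_at_irrefl:
  assumes "rooted_at V E r"
  shows "(v, v) \<notin> E"
  using rooted_at_acyclic[OF assms] by blast

lemma sub_verts_refl: "v \<in> sub_verts E v"
  by (simp add: sub_verts_def)

lemma sub_verts_subset:
  assumes "rooted_at V E r" "v \<in> V"
  shows "sub_verts E v \<subseteq> V"
proof
  fix w assume "w \<in> sub_verts E v"
  then have "(v, w) \<in> E\<^sup>*" by (simp add: sub_verts_def)
  then show "w \<in> V" by (induction) (use assms in \<open>auto simp: rooted_at_def\<close>)
qed

lemma sub_verts_closed: "w \<in> sub_verts E v \<Longrightarrow> (w, x) \<in> E \<Longrightarrow> x \<in> sub_verts E v"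
  by (auto simp: sub_verts_def)

lemma sub_edges_eq: "sub_edges E v = {(x, y). (x, y) \<in> E \<and> x \<in> sub_verts E v}"
  by (auto simp: sub_edges_def intro: sub_verts_closed)

lemma rtrancl_sub_edges:
  assumes "x \<in> sub_verts E v"
  shows "(x, y) \<in> (sub_edges E v)\<^sup>* \<longleftrightarrow> (x, y) \<in> E\<^sup>*"
proof
  assume "(x, y) \<in> (sub_edges E v)\<^sup>*"
  then show "(x, y) \<in> E\<^sup>*" by (rule rev_subsetD[OF _ rtrancl_mono]) (auto simp: sub_edges_def)
next
  assume "(x, y) \<in> E\<^sup>*"
  then have "(x, y) \<in> (sub_edges E v)\<^sup>* \<and> y \<in> sub_verts E v"
  proof (induction)
    case (step y z)
    then have "(y, z) \<in> sub_edges E v" by (simp add: sub_edges_eq)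
    with step show ?case by (meson rtrancl.rtrancl_into_rtrancl sub_verts_closed)
  qed (simp add: assms)
  then show "(x, y) \<in> (sub_edges E v)\<^sup>*" ..
qed

lemma sub_verts_sub_edges:
  assumes "x \<in> sub_verts E v"
  shows "sub_verts (sub_edges E v) x = sub_verts E x"
  using rtrancl_sub_edges[OF assms] by (auto simp: sub_verts_def)

lemma sub_edges_sub_edges:
  assumes "x \<in> sub_verts E v"
  shows "sub_edges (sub_edges E v) x = sub_edges E x"
  unfolding sub_edges_eq[of "sub_edges E v"] sub_verts_sub_edges[OF assms]
proof -
  have "sub_verts E x \<subseteq> sub_verts E v" using assms by (auto simp: sub_verts_def)
  then show "{(y, z). (y, z) \<in> sub_edges E v \<and> y \<in> sub_verts E x} = sub_edges E x"
    by (auto simp: sub_edges_eq)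
qed

lemma rooted_at_subtree:
  assumes "rooted_at V E r" "v \<in> V"
  shows "rooted_at (sub_verts E v) (sub_edges E v) v"
  unfolding rooted_at_def
proof (intro conjI ballI allI)
  show "finite (sub_verts E v)"
    using sub_verts_subset[OF assms] assms(1) by (meson finite_subset rooted_at_def)
  show "sub_edges E v \<subseteq> sub_verts E v \<times> sub_verts E v" by (auto simp: sub_edges_def)
  show "(u, v) \<notin> sub_edges E v" for u
  proof
    assume "(u, v) \<in> sub_edges E v"
    then have "(v, v) \<in> E\<^sup>+" by (auto simp: sub_edges_def sub_verts_def)
    then show False using rooted_at_acyclic[OF assms(1)] by blast
  qed
  show "\<exists>!u. (u, w) \<in> sub_edges E v" if w: "w \<in> sub_verts E v - {v}" for w
  proof -
    have "(v, w) \<in> E\<^sup>*" "v \<noteq> w" using w by (auto simp: sub_verts_def)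
    then obtain u where "(v, u) \<in> E\<^sup>*" "(u, w) \<in> E" by (meson rtranclE)
    then have "(u, w) \<in> sub_edges E v" by (simp add: sub_edges_eq sub_verts_def)
    moreover have "u' = u" if "(u', w) \<in> sub_edges E v" for u'
      using rooted_at_unique_parent[OF assms(1)] that \<open>(u, w) \<in> E\<close> by (auto simp: sub_edges_def)
    ultimately show ?thesis by blast
  qed
  show "(v, w) \<in> (sub_edges E v)\<^sup>*" if "w \<in> sub_verts E v" for w
    using that rtrancl_sub_edges[OF sub_verts_refl, where y = w] by (simp add: sub_verts_def)
qed (simp add: sub_verts_refl)

lemma sub_verts_root:
  assumes "rooted_at V E r"
  shows "sub_verts E r = V"
  using assms sub_verts_subset[OF assms, of r] by (auto simp: rooted_at_def sub_verts_def)

lemma sub_edges_root: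
  assumes "rooted_at V E r"
  shows "sub_edges E r = E"
  using assms sub_verts_root[OF assms] by (auto simp: rooted_at_def sub_edges_def)

definition children :: "('a \<times> 'a) set \<Rightarrow> 'a \<Rightarrow> 'a set" where
  "children E v = {c. (v, c) \<in> E}"

lemma children_sub_edges: "children (sub_edges E v) v = children E v"
  by (auto simp: children_def sub_edges_eq sub_verts_refl)

lemma finite_children:
  assumes "rooted_at V E r"
  shows "finite (children E v)"
  using assms by (auto simp: rooted_at_def children_def intro: finite_subset[of _ V])

lemma child_in_V:
  assumes "rooted_at V E r" "c \<in> children E v"
  shows "c \<in> V"
  using assms by (auto simp: rooted_at_def children_def)

lemma root_notin_sub_verts_child:
  assumes "rooted_at V E r" "c \<in> children E r"
  shows "r \<notin> sub_verts E c"
proof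
  assume "r \<in> sub_verts E c"
  then have "(r, r) \<in> E\<^sup>+" using assms(2) by (auto simp: sub_verts_def children_def)
  then show False using rooted_at_acyclic[OF assms(1)] by blast
qed

text \<open>A common vertex would drag its unique parent into both subtrees, and so on up to
  \<open>c\<close> or \<open>c'\<close>. But no child of \<open>r\<close> lies below another one, as
  its only parent \<open>r\<close> lies in no child subtree.\<close>

lemma sub_verts_children_disjoint:
  assumes T: "rooted_at V E r" and c: "c \<in> children E r" "c' \<in> children E r" "c \<noteq> c'"
  shows "sub_verts E c \<inter> sub_verts E c' = {}"
proof -
  have *: "b \<notin> sub_verts E a" if a: "a \<in> children E r" "b \<in> children E r" "a \<noteq> b" for a b
  proof
    assume "b \<in> sub_verts E a"
    then have "(a, b) \<in> E\<^sup>*" by (simp add: sub_verts_def)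
    then obtain u where u: "(a, u) \<in> E\<^sup>*" "(u, b) \<in> E" using a(3) by (meson rtranclE)
    then have "u = r" using rooted_at_unique_parent[OF T] a(2) by (simp add: children_def)
    then show False using u(1) root_notin_sub_verts_child[OF T a(1)] by (simp add: sub_verts_def)
  qed
  have "w \<notin> sub_verts E c'" if "(c, w) \<in> E\<^sup>*" for w
    using that
  proof (induction)
    case base
    show ?case using * c by blast
  next
    case (step u w)
    show ?case
    proof
      assume w: "w \<in> sub_verts E c'"
      have "w \<in> sub_verts E c" using step(1,2) by (auto simp: sub_verts_def)
      then have "c' \<noteq> w" using *[OF c] by blast
      moreover have "(c', w) \<in> E\<^sup>*" using w by (simp add: sub_verts_def)
      ultimately obtain x where "(c', x) \<in> E\<^sup>*" "(x, w) \<in> E"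
        by (meson rtranclE)
      moreover have "x = u" using rooted_at_unique_parent[OF T] step(2) \<open>(x, w) \<in> E\<close> by blast
      ultimately show False using step.IH by (simp add: sub_verts_def)
    qed
  qed
  then show ?thesis by (auto simp: sub_verts_def)
qed

lemma verts_decomp:
  assumes T: "rooted_at V E r"
  shows "V = insert r (\<Union>c \<in> children E r. sub_verts E c)"
proof -
  have "w \<in> insert r (\<Union>c \<in> children E r. sub_verts E c)" if "w \<in> V" for w
  proof -
    have "(r, w) \<in> E\<^sup>*" using T that by (simp add: rooted_at_def)
    then show ?thesis
      by (rule converse_rtranclE) (auto simp: children_def sub_verts_def)
  qed
  moreover have "sub_verts E c \<subseteq> V" if "c \<in> children E r" for c
    using sub_verts_subset[OF T child_in_V[OF T that]] .
  moreover have "r \<in> V" using T by (simp add: rooted_at_def)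
  ultimately show ?thesis by blast
qed

lemma card_sub_verts_child:
  assumes T: "rooted_at V E r" and "c \<in> children E r"
  shows "card (sub_verts E c) < card V"
proof (rule psubset_card_mono)
  show "finite V" using T by (simp add: rooted_at_def)
  show "sub_verts E c \<subset> V"
    using sub_verts_subset[OF T child_in_V[OF assms]] root_notin_sub_verts_child[OF assms] T
    by (auto simp: rooted_at_def)
qed

lemma edges_finite: "rooted_at V E r \<Longrightarrow> finite E"
  by (auto simp: rooted_at_def intro: finite_subset[of E "V \<times> V"])

text \<open>With the root placed, an edge from the root is cut exactly as long as its child is
  missing from \<open>P\<close>; every other edge lies in exactly one child subtree.\<close>

lemma prefix_cut_decomp:
  assumes T: "rooted_at V E r" and "r \<in> P"
  shows "prefix_cut E P = card (children E r - P) + (\<Sum>c \<in> children E r. prefix_cut (sub_edges E c) P)"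
proof -
  let ?X = "\<lambda>F. {(v, w). (v, w) \<in> F \<and> v \<in> P \<and> w \<notin> P}"
  have fin: "finite (?X F)" if "F \<subseteq> E" for F
    using edges_finite[OF T] that by (auto intro: finite_subset)
  have sub: "sub_edges E c \<subseteq> E" for c by (auto simp: sub_edges_def)
  have split: "?X E = Pair r ` (children E r - P) \<union> (\<Union>c \<in> children E r. ?X (sub_edges E c))"
  proof -
    have "v \<in> V" if "(v, w) \<in> E" for v w using T that unfolding rooted_at_def by blast
    then have "v = r \<or> (\<exists>c \<in> children E r. v \<in> sub_verts E c)" if "(v, w) \<in> E" for v w
      using verts_decomp[OF T] that by blast
    then show ?thesis using assms(2) by (fastforce simp: sub_edges_eq children_def)
  qed
  have "prefix_cut E P = card (Pair r ` (children E r - P)) + card (\<Union>c \<in> children E r. ?X (sub_edges E c))"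
    unfolding prefix_cut_def split
  proof (rule card_Un_disjoint)
    show "Pair r ` (children E r - P) \<inter> (\<Union>c \<in> children E r. ?X (sub_edges E c)) = {}"
      using root_notin_sub_verts_child[OF T] by (auto simp: sub_edges_def)
  qed (use finite_children[OF T] fin[OF sub] in auto)
  also have "card (Pair r ` (children E r - P)) = card (children E r - P)"
    by (simp add: card_image inj_on_def)
  also have "card (\<Union>c \<in> children E r. ?X (sub_edges E c)) =
      (\<Sum>c \<in> children E r. prefix_cut (sub_edges E c) P)"
    unfolding prefix_cut_def
  proof (rule card_UN_disjoint)
    show "\<forall>c \<in> children E r. \<forall>c' \<in> children E r. c \<noteq> c' \<longrightarrow> ?X (sub_edges E c) \<inter> ?X (sub_edges E c') = {}"
      using sub_verts_children_disjoint[OF T] by (fastforce simp: sub_edges_def)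
  qed (use finite_children[OF T] fin[OF sub] in auto)
  finally show ?thesis .
qed

lemma prefix_cut_cong:
  assumes "E \<subseteq> V \<times> V" "P \<inter> V = Q \<inter> V"
  shows "prefix_cut E P = prefix_cut E Q"
proof -
  have "{(v, w). (v, w) \<in> E \<and> v \<in> P \<and> w \<notin> P} = {(v, w). (v, w) \<in> E \<and> v \<in> Q \<and> w \<notin> Q}"
    using assms by blast
  then show ?thesis by (simp add: prefix_cut_def)
qed

section \<open>The recursion for the directed cutwidth\<close>

definition comb :: "nat list \<Rightarrow> nat" where
  "comb ds = foldl (\<lambda>m d. max (Suc m) d) 0 ds"

lemma comb_Nil [simp]: "comb [] = 0"
  by (simp add: comb_def)

lemma comb_snoc [simp]: "comb (ds @ [d]) = max (Suc (comb ds)) d"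
  by (simp add: comb_def)

text \<open>Appending a width raises the length and every earlier term by one, matching the
  \<open>Suc\<close> in the fold; the new width has no subtree behind it and contributes itself.
  Positions count from 0, hence \<open>Suc i\<close>.\<close>

lemma comb_le_iff:
  "comb ds \<le> X \<longleftrightarrow> length ds \<le> X \<and> (\<forall>i < length ds. ds ! i + (length ds - Suc i) \<le> X)"
proof (induction ds arbitrary: X rule: rev_induct)
  case (snoc d ds)
  show ?case
  proof (cases X)
    case (Suc Y)
    have "comb (ds @ [d]) \<le> X \<longleftrightarrow> comb ds \<le> Y \<and> d \<le> X" using Suc by simp
    also have "\<dots> \<longleftrightarrow> length ds \<le> Y \<and> (\<forall>i < length ds. ds ! i + (length ds - Suc i) \<le> Y) \<and> d \<le> X"
      using snoc by simp
    also have "\<dots> \<longleftrightarrow> length (ds @ [d]) \<le> X \<and>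
        (\<forall>i < length (ds @ [d]). (ds @ [d]) ! i + (length (ds @ [d]) - Suc i) \<le> X)"
      using Suc by (auto simp: nth_append less_Suc_eq Suc_diff_Suc)
    finally show ?thesis .
  qed simp
qed simp

section \<open>Lower bound: no serialization is narrower than the recursion says\<close>

lemma rooted_at_finite: "rooted_at V E r \<Longrightarrow> finite V"
  by (simp add: rooted_at_def)

lemma serialization_props:
  assumes T: "rooted_at V E r" and S: "serialization V E S"
  shows "distinct S" "set S = V" "V \<noteq> {}" "E \<subseteq> V \<times> V"
    and "(v, w) \<in> E \<Longrightarrow> w \<in> set (take i S) \<Longrightarrow> v \<in> set (take i S)"
proof -
  show EV: "E \<subseteq> V \<times> V" and "V \<noteq> {}" using T by (auto simp: rooted_at_def)
  show "distinct S" "set S = V" "(v, w) \<in> E \<Longrightarrow> w \<in> set (take i S) \<Longrightarrow> v \<in> set (take i S)"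
    using S unfolding serialization_iff[OF EV rooted_at_irrefl[OF T]] by blast+
qed

text \<open>Any other first vertex would have its parent inside the prefix of length one and so be
  its own parent.\<close>

lemma serialization_root_first:
  assumes T: "rooted_at V E r" and S: "serialization V E S" and "i > 0"
  shows "r \<in> set (take i S)"
proof -
  note props = serialization_props[OF T S]
  obtain x xs where x: "S = x # xs" using props by (cases S) auto
  have "x = r"
  proof (rule ccontr)
    assume "x \<noteq> r"
    then have "x \<in> V - {r}" using x props by auto
    then have "\<exists>!u. (u, x) \<in> E" using T by (simp add: rooted_at_def)
    then obtain u where u: "(u, x) \<in> E" by blast
    then have "u \<in> set (take 1 S)" using props(5)[of u x 1] x by simp
    then show False using u rooted_at_irrefl[OF T] x by simp
  qed
  then show ?thesis using x \<open>i > 0\<close> by (cases i) auto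
qed

lemma card_children_le_dcw_ser:
  assumes T: "rooted_at V E r" and S: "serialization V E S"
  shows "card (children E r) \<le> dcw_ser V E S"
proof -
  note props = serialization_props[OF T S]
  have "set (take 1 S) = {r}"
    using serialization_root_first[OF T S, of 1] by (cases S) auto
  then have "prefix_cut E {r} \<le> dcw_ser V E S"
    using prefix_cut_le_dcw_ser[OF props(1-4), of 1] by simp
  moreover have "children E r - {r} = children E r"
    using rooted_at_irrefl[OF T] by (auto simp: children_def)
  ultimately show ?thesis using prefix_cut_decomp[OF T, of "{r}"] by simp
qed

lemma serialization_filter:
  assumes T: "rooted_at V E r" and S: "serialization V E S" and "v \<in> V"
  shows "serialization (sub_verts E v) (sub_edges E v) (filter (\<lambda>x. x \<in> sub_verts E v) S)"
proof -
  note props = serialization_props[OF T S]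
  note sub = rooted_at_subtree[OF T \<open>v \<in> V\<close>]
  have EV: "sub_edges E v \<subseteq> sub_verts E v \<times> sub_verts E v" using sub by (simp add: rooted_at_def)
  show ?thesis
    unfolding serialization_iff[OF EV rooted_at_irrefl[OF sub]]
  proof (intro conjI allI impI)
    show "set (filter (\<lambda>x. x \<in> sub_verts E v) S) = sub_verts E v"
      using sub_verts_subset[OF T \<open>v \<in> V\<close>] props(2) by auto
    fix i x y assume e: "(x, y) \<in> sub_edges E v" "y \<in> set (take i (filter (\<lambda>x. x \<in> sub_verts E v) S))"
    obtain j where j: "take i (filter (\<lambda>x. x \<in> sub_verts E v) S) = filter (\<lambda>x. x \<in> sub_verts E v) (take j S)"
      using take_filter_ex by blast
    show "x \<in> set (take i (filter (\<lambda>x. x \<in> sub_verts E v) S))"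
      using e props(5)[of x y j] unfolding j by (auto simp: sub_edges_def)
  qed (use props in auto)
qed

text \<open>The word restricted to the subtree is one of its serializations, so some prefix of it
  has a cut of at least \<open>m\<close>, and this prefix is the trace of a prefix of
  \<open>S\<close>. Since \<open>m > 0\<close>, the claim can be read as failure of the bound
  \<open>m - 1\<close>.\<close>

lemma subtree_cut_reached:
  assumes T: "rooted_at V E r" and S: "serialization V E S" and "v \<in> V"
    and m: "m > 0" "m \<le> dcw (sub_verts E v) (sub_edges E v)"
  shows "\<exists>t. m \<le> prefix_cut (sub_edges E v) (set (take t S))"
proof -
  let ?S = "filter (\<lambda>x. x \<in> sub_verts E v) S"
  note sub = rooted_at_subtree[OF T \<open>v \<in> V\<close>]
  note S' = serialization_filter[OF T S \<open>v \<in> V\<close>]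
  note props = serialization_props[OF sub S']
  have "m \<le> dcw_ser (sub_verts E v) (sub_edges E v) ?S"
    using m(2) dcw_le[OF rooted_at_finite[OF sub] S'] by linarith
  then have "\<not> dcw_ser (sub_verts E v) (sub_edges E v) ?S \<le> m - 1" using m(1) by linarith
  then obtain i where i: "\<not> prefix_cut (sub_edges E v) (set (take i ?S)) \<le> m - 1"
    using dcw_ser_le_iff[OF props(1-4)] by blast
  obtain j where j: "take i ?S = filter (\<lambda>x. x \<in> sub_verts E v) (take j S)"
    using take_filter_ex by blast
  have "prefix_cut (sub_edges E v) (set (take i ?S)) = prefix_cut (sub_edges E v) (set (take j S))"
    unfolding j by (rule prefix_cut_cong[OF props(4)]) auto
  then have "m \<le> prefix_cut (sub_edges E v) (set (take j S))" using i m(1) by linarith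
  then show ?thesis ..
qed

lemma prefix_cut_pos_iff:
  assumes "finite E"
  shows "prefix_cut E P > 0 \<longleftrightarrow> (\<exists>v w. (v, w) \<in> E \<and> v \<in> P \<and> w \<notin> P)"
proof -
  have "finite {(v, w). (v, w) \<in> E \<and> v \<in> P \<and> w \<notin> P}" using assms by (auto intro: finite_subset)
  then show ?thesis unfolding prefix_cut_def card_gt_0_iff by auto
qed

lemma unfinished_subtree_cut_pos:
  assumes T: "rooted_at V E r" and "r \<in> P" "w \<in> V" "w \<notin> P"
  shows "prefix_cut E P > 0"
proof -
  have "(r, w) \<in> E\<^sup>*" using T assms by (simp add: rooted_at_def)
  then have "\<exists>x y. (x, y) \<in> E \<and> x \<in> P \<and> y \<notin> P" using \<open>w \<notin> P\<close>
  proof (induction)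
    case base
    then show ?case using \<open>r \<in> P\<close> by blast
  qed blast
  then show ?thesis using prefix_cut_pos_iff[OF edges_finite[OF T]] by blast
qed

text \<open>Among the child subtrees in \<open>A\<close>, look at the first moment at which one of them reaches a cut
  of size \<open>m\<close>: every other one is unfinished at that moment and so contributes an edge, either its
  own or the one from the root.\<close>

lemma children_bound_dcw_ser:
  assumes T: "rooted_at V E r" and S: "serialization V E S"
    and A: "A \<subseteq> children E r" "A \<noteq> {}" and "m > 0"
    and m: "\<And>c. c \<in> A \<Longrightarrow> m \<le> dcw (sub_verts E c) (sub_edges E c)"
  shows "m + (card A - 1) \<le> dcw_ser V E S"
proof -
  note props = serialization_props[OF T S]
  have finC: "finite (children E r)" using finite_children[OF T] .
  then have finA: "finite A" using A finite_subset by blast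
  have "\<exists>t. m \<le> prefix_cut (sub_edges E c) (set (take t S))" if "c \<in> A" for c
    using subtree_cut_reached[OF T S _ \<open>m > 0\<close> m[OF that]] child_in_V[OF T] A that by blast
  then obtain t where t: "\<And>c. c \<in> A \<Longrightarrow> m \<le> prefix_cut (sub_edges E c) (set (take (t c) S))"
    by metis
  obtain a where a: "a \<in> A" "\<And>c. c \<in> A \<Longrightarrow> t a \<le> t c"
    using arg_min_if_finite[OF finA A(2), of t] by (metis not_le)
  let ?P = "set (take (t a) S)"
  have fin_sub: "finite (sub_edges E c)" for c
    using edges_finite[OF T] by (simp add: sub_edges_def)
  \<comment> \<open>The empty prefix cuts nothing, so a positive cut occurs only after the root has
    been placed.\<close>
  have "t a > 0" using t[OF a(1)] \<open>m > 0\<close> by (cases "t a = 0") (auto simp: prefix_cut_def)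
  then have rP: "r \<in> ?P" using serialization_root_first[OF T S] by blast
  let ?f = "\<lambda>c. (if c \<in> ?P then 0 else 1) + prefix_cut (sub_edges E c) ?P"
  \<comment> \<open>An absent \<open>c\<close> contributes its edge from the root. If
    \<open>c\<close> is placed, its subtree still has a cut edge at \<open>t c\<close>, which is not
    before \<open>t a\<close>; the target of that edge is absent at \<open>t a\<close> too.\<close>
  have pos: "1 \<le> ?f c" if c: "c \<in> A" for c
  proof (cases "c \<in> ?P")
    case True
    have "0 < prefix_cut (sub_edges E c) (set (take (t c) S))" using t[OF c] \<open>m > 0\<close> by linarith
    then obtain v w where w: "(v, w) \<in> sub_edges E c" "w \<notin> set (take (t c) S)"
      using prefix_cut_pos_iff[OF fin_sub] by blast
    then have "w \<notin> ?P" using set_take_subset_set_take[OF a(2)[OF c], of S] by blast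
    moreover have "w \<in> sub_verts E c" using w by (simp add: sub_edges_def)
    moreover have "c \<in> V" using child_in_V[OF T] A c by blast
    ultimately have "prefix_cut (sub_edges E c) ?P > 0"
      using unfinished_subtree_cut_pos[OF rooted_at_subtree[OF T] True] by blast
    then show ?thesis by simp
  qed simp
  have "m + (card A - 1) \<le> ?f a + (\<Sum>c \<in> A - {a}. ?f c)"
  proof (rule add_mono)
    show "m \<le> ?f a" using t[OF a(1)] by simp
    have "card A - 1 = (\<Sum>c \<in> A - {a}. 1)" using a(1) by simp
    also have "\<dots> \<le> (\<Sum>c \<in> A - {a}. ?f c)" using pos by (intro sum_mono) blast
    finally show "card A - 1 \<le> (\<Sum>c \<in> A - {a}. ?f c)" .
  qed
  also have "\<dots> = (\<Sum>c \<in> A. ?f c)" using sum.remove[OF finA a(1), of ?f] by simp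
  also have "\<dots> \<le> (\<Sum>c \<in> children E r. ?f c)" using A finC by (intro sum_mono2) auto
  also have "\<dots> = card (children E r - ?P) + (\<Sum>c \<in> children E r. prefix_cut (sub_edges E c) ?P)"
  proof -
    have "(\<Sum>c \<in> children E r. if c \<in> ?P then 0 else 1) = (\<Sum>c \<in> children E r - ?P. 1 :: nat)"
      using finC by (intro sum.mono_neutral_cong_right) auto
    then show ?thesis by (simp add: sum.distrib)
  qed
  also have "\<dots> = prefix_cut E ?P" using prefix_cut_decomp[OF T rP] by simp
  also have "\<dots> \<le> dcw_ser V E S" using prefix_cut_le_dcw_ser[OF props(1-4)] .
  finally show ?thesis .
qed

text \<open>The term of index \<open>i\<close> is the bound for the child subtrees from
  \<open>i\<close> on, with the width at \<open>i\<close> as threshold; sortedness puts all of them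
  above the threshold.\<close>

lemma comb_le_dcw_ser:
  assumes T: "rooted_at V E r" and S: "serialization V E S"
    and cs: "distinct cs" "set cs = children E r"
    and srt: "sorted (map (\<lambda>c. dcw (sub_verts E c) (sub_edges E c)) cs)"
  shows "comb (map (\<lambda>c. dcw (sub_verts E c) (sub_edges E c)) cs) \<le> dcw_ser V E S"
proof -
  let ?D = "\<lambda>c. dcw (sub_verts E c) (sub_edges E c)"
  have l: "length cs \<le> dcw_ser V E S"
    using card_children_le_dcw_ser[OF T S] distinct_card[OF cs(1)] cs(2) by simp
  moreover have "?D (cs ! i) + (length cs - Suc i) \<le> dcw_ser V E S" if i: "i < length cs" for i
  \<comment> \<open>A width of 0 is no positive threshold, but its term is below the number of
    children.\<close>
  proof (cases "?D (cs ! i) = 0")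
    case True
    then show ?thesis using l by simp
  next
    case False
    have card: "card (set (drop i cs)) = length cs - i"
      using cs(1) distinct_card[of "drop i cs"] by simp
    have "?D (cs ! i) + (card (set (drop i cs)) - 1) \<le> dcw_ser V E S"
    proof (rule children_bound_dcw_ser[OF T S])
      show "set (drop i cs) \<subseteq> children E r" using cs(2) set_drop_subset by fastforce
      show "set (drop i cs) \<noteq> {}" using i by simp
      fix c assume "c \<in> set (drop i cs)"
      then obtain k where "k < length cs - i" "c = cs ! (i + k)"
        by (auto simp: in_set_conv_nth)
      then show "?D (cs ! i) \<le> ?D c" using sorted_nth_mono[OF srt, of i "i + k"] i by simp
    qed (use False in simp)
    then show ?thesis unfolding card by simp
  qed
  ultimately show ?thesis by (simp add: comb_le_iff)
qed

section \<open>Upper bound: serializing the child subtrees one after the other\<close>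

lemma take_concat_cases:
  "take n (concat Ss) = concat Ss \<or>
   (\<exists>j < length Ss. \<exists>k < length (Ss ! j). take n (concat Ss) = concat (take j Ss) @ take k (Ss ! j))"
proof (induction Ss arbitrary: n)
  case (Cons S Ss)
  show ?case
  proof (cases "n < length S")
    case True
    then show ?thesis by (intro disjI2 exI[of _ 0]) auto
  next
    case False
    then have eq: "take n (concat (S # Ss)) = S @ take (n - length S) (concat Ss)" by simp
    from Cons[of "n - length S"] show ?thesis
    proof (elim disjE exE conjE)
      fix j k assume "j < length Ss" "k < length (Ss ! j)"
        "take (n - length S) (concat Ss) = concat (take j Ss) @ take k (Ss ! j)"
      then show ?thesis unfolding eq by (intro disjI2 exI[of _ "Suc j"]) auto
    qed (use False in simp)
  qed
qed simp

lemma distinct_concat_list_all2: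
  assumes "list_all2 (\<lambda>c S. distinct S \<and> set S = F c) cs Ss" "distinct cs"
    and "\<And>c c'. c \<in> set cs \<Longrightarrow> c' \<in> set cs \<Longrightarrow> c \<noteq> c' \<Longrightarrow> F c \<inter> F c' = {}"
  shows "distinct (concat Ss) \<and> set (concat Ss) = (\<Union>c \<in> set cs. F c)"
  using assms
proof (induction rule: list_all2_induct)
  case (Cons c cs S Ss)
  have "distinct (concat Ss) \<and> set (concat Ss) = (\<Union>c \<in> set cs. F c)" using Cons by simp
  moreover have "F c \<inter> F c' = {}" if "c' \<in> set cs" for c'
    using Cons.prems(2)[of c c'] Cons.prems(1) that by auto
  then have "F c \<inter> (\<Union>c \<in> set cs. F c) = {}" by blast
  ultimately show ?case using Cons.hyps by auto
qed simp

lemma prefix_cut_disjoint: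
  assumes "E \<subseteq> V \<times> V" "P \<inter> V = {}"
  shows "prefix_cut E P = 0"
  using prefix_cut_cong[OF assms(1), of P "{}"] assms(2) by (simp add: prefix_cut_def)

lemma prefix_cut_superset:
  assumes "E \<subseteq> V \<times> V" "V \<subseteq> P"
  shows "prefix_cut E P = 0"
proof -
  have "{(v, w). (v, w) \<in> E \<and> v \<in> P \<and> w \<notin> P} = {}" using assms by blast
  then show ?thesis unfolding prefix_cut_def by (metis card.empty)
qed

lemma parent_in_child_subtree:
  assumes T: "rooted_at V E r" and "c \<in> children E r" "w \<in> sub_verts E c" "(v, w) \<in> E" "v \<noteq> r"
  shows "v \<in> sub_verts E c"
proof -
  have "v \<in> V" using assms by (auto simp: rooted_at_def)
  then obtain c' where c': "c' \<in> children E r" "v \<in> sub_verts E c'"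
    using verts_decomp[OF T] assms(5) by blast
  then have "w \<in> sub_verts E c'" using assms(4) sub_verts_closed by metis
  then have "c = c'" using sub_verts_children_disjoint[OF T assms(2) c'(1)] assms(3) by blast
  then show ?thesis using c' by simp
qed

text \<open>While the word of child \<open>j\<close> is read, earlier subtrees are complete and
  later ones untouched, so only the cut inside subtree \<open>j\<close> and the pending edges from
  the root count. The estimate holds for the children in any order; sorting is what makes the lower
  bound meet it.\<close>

lemma concat_serializations:
  assumes T: "rooted_at V E r" and cs: "distinct cs" "set cs = children E r"
    and Ss: "list_all2 (\<lambda>c S. serialization (sub_verts E c) (sub_edges E c) S) cs Ss"
  shows "serialization V E (r # concat Ss)"
    and "dcw_ser V E (r # concat Ss) \<le> comb (map2 (\<lambda>c S. dcw_ser (sub_verts E c) (sub_edges E c) S) cs Ss)"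
      (is "_ \<le> comb ?ds")
proof -
  have len: "length Ss = length cs" using Ss by (simp add: list_all2_lengthD)
  have EV: "E \<subseteq> V \<times> V" and V: "V \<noteq> {}" using T by (auto simp: rooted_at_def)
  have child: "cs ! j \<in> children E r" if "j < length cs" for j using nth_mem[OF that] cs(2) by simp
  have ser: "serialization (sub_verts E (cs ! j)) (sub_edges E (cs ! j)) (Ss ! j)"
    if "j < length cs" for j using Ss that by (simp add: list_all2_conv_all_nth)
  have sub: "rooted_at (sub_verts E (cs ! j)) (sub_edges E (cs ! j)) (cs ! j)" if "j < length cs" for j
    using rooted_at_subtree[OF T child_in_V[OF T child[OF that]]] .
  have sprops: "distinct (Ss ! j)" "set (Ss ! j) = sub_verts E (cs ! j)" "sub_verts E (cs ! j) \<noteq> {}"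
      "sub_edges E (cs ! j) \<subseteq> sub_verts E (cs ! j) \<times> sub_verts E (cs ! j)"
      "\<And>v w k. (v, w) \<in> sub_edges E (cs ! j) \<Longrightarrow> w \<in> set (take k (Ss ! j)) \<Longrightarrow> v \<in> set (take k (Ss ! j))"
    if "j < length cs" for j
    using serialization_props[OF sub[OF that] ser[OF that]] by blast+
  have "list_all2 (\<lambda>c S. distinct S \<and> set S = sub_verts E c) cs Ss"
    using Ss by (rule list_all2_mono) (auto simp: serialization_def)
  then have dc: "distinct (concat Ss)" and sc: "set (concat Ss) = (\<Union>c \<in> children E r. sub_verts E c)"
    using distinct_concat_list_all2[of "sub_verts E" cs Ss] cs sub_verts_children_disjoint[OF T] by auto
  have setS: "set (r # concat Ss) = V" using sc verts_decomp[OF T] by simp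
  have dS: "distinct (r # concat Ss)" using dc sc root_notin_sub_verts_child[OF T] by auto
  have pre: "set (concat (take j Ss)) = (\<Union>i \<in> {..<j}. sub_verts E (cs ! i))" if j: "j < length cs" for j
  proof -
    have "set (take j Ss) = (!) Ss ` {..<j}" using nth_image[of j Ss] j len by (simp add: lessThan_atLeast0)
    then show ?thesis using sprops(2) j by auto
  qed
  show S: "serialization V E (r # concat Ss)"
    unfolding serialization_iff[OF EV rooted_at_irrefl[OF T]]
  proof (intro conjI allI impI)
    fix i v w assume e: "(v, w) \<in> E" and w: "w \<in> set (take i (r # concat Ss))"
    show "v \<in> set (take i (r # concat Ss))"
    proof (cases i)
      case 0
      then show ?thesis using w by simp
    next
      case (Suc n)
      have wr: "w \<noteq> r" using e T by (auto simp: rooted_at_def)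
      have wn: "w \<in> set (take n (concat Ss))" using w wr Suc by auto
      have "v \<in> set (take n (concat Ss))" if vr: "v \<noteq> r"
        using take_concat_cases[of n Ss]
      proof (elim disjE exE conjE)
        assume "take n (concat Ss) = concat Ss"
        moreover have "v \<in> V" using e EV by auto
        ultimately show ?thesis using vr setS by auto
      next
        fix j k assume jk: "j < length Ss" "k < length (Ss ! j)"
          and tk: "take n (concat Ss) = concat (take j Ss) @ take k (Ss ! j)"
        have j: "j < length cs" using jk len by simp
        consider i where "i < j" "w \<in> sub_verts E (cs ! i)" | "w \<in> set (take k (Ss ! j))"
          using wn pre[OF j] unfolding tk by auto
        then show ?thesis
        proof cases
          case (1 i)
          then have "v \<in> sub_verts E (cs ! i)"
            using parent_in_child_subtree[OF T child _ e vr] j by simp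
          then show ?thesis using 1 pre[OF j] unfolding tk by auto
        next
          case 2
          then have "w \<in> sub_verts E (cs ! j)" using sprops(2)[OF j] set_take_subset[of k "Ss ! j"] by blast
          then have "v \<in> sub_verts E (cs ! j)"
            using parent_in_child_subtree[OF T child[OF j] _ e vr] by simp
          then have "(v, w) \<in> sub_edges E (cs ! j)" using e by (simp add: sub_edges_eq)
          then show ?thesis using sprops(5)[OF j _ 2] unfolding tk by simp
        qed
      qed
      then show ?thesis using Suc by auto
    qed
  qed (use setS dS in auto)
  have ds: "length ?ds = length cs" "\<And>j. j < length cs \<Longrightarrow> ?ds ! j = dcw_ser (sub_verts E (cs ! j)) (sub_edges E (cs ! j)) (Ss ! j)"
    using len by simp_all
  have "prefix_cut E (set (take i (r # concat Ss))) \<le> comb ?ds" for i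
  proof (cases i)
    case 0
    then show ?thesis by (simp add: prefix_cut_def)
  next
    case (Suc n)
    show ?thesis
      using take_concat_cases[of n Ss]
    proof (elim disjE exE conjE)
      assume "take n (concat Ss) = concat Ss"
      then have "set (take i (r # concat Ss)) = V" using Suc setS by simp
      then show ?thesis using prefix_cut_superset[OF EV] by simp
    next
      fix j k assume jk: "j < length Ss" "k < length (Ss ! j)"
        and tk: "take n (concat Ss) = concat (take j Ss) @ take k (Ss ! j)"
      have j: "j < length cs" using jk len by simp
      let ?P = "set (take i (r # concat Ss))"
      have P: "?P = insert r ((\<Union>i \<in> {..<j}. sub_verts E (cs ! i)) \<union> set (take k (Ss ! j)))"
        using tk pre[OF j] Suc by simp
      have Sj: "set (take k (Ss ! j)) \<subseteq> sub_verts E (cs ! j)" using sprops(2)[OF j] set_take_subset[of k "Ss ! j"] by blast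
      have other: "prefix_cut (sub_edges E (cs ! i)) ?P = 0" if i: "i < length cs" "i \<noteq> j" for i
      proof (cases "i < j")
        case True
        then have "sub_verts E (cs ! i) \<subseteq> ?P" unfolding P by auto
        then show ?thesis using prefix_cut_superset[OF sprops(4)[OF i(1)]] by blast
      next
        case False
        have "sub_verts E (cs ! i') \<inter> sub_verts E (cs ! i) = {}" if "i' \<le> j" for i'
          using sub_verts_children_disjoint[OF T child child, of i' i] that i j False cs(1)
          by (simp add: nth_eq_iff_index_eq)
        then have "(\<Union>i' \<in> {..<j}. sub_verts E (cs ! i')) \<inter> sub_verts E (cs ! i) = {}"
            "sub_verts E (cs ! j) \<inter> sub_verts E (cs ! i) = {}"
          unfolding disjoint_iff by (meson UN_E lessThan_iff less_imp_le order_refl)+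
        then have "?P \<inter> sub_verts E (cs ! i) = {}"
          using Sj root_notin_sub_verts_child[OF T child[OF i(1)]] unfolding P by blast
        then show ?thesis using prefix_cut_disjoint[OF sprops(4)[OF i(1)]] by blast
      qed
      have "?P \<inter> sub_verts E (cs ! j) = set (take k (Ss ! j)) \<inter> sub_verts E (cs ! j)"
      proof -
        have "sub_verts E (cs ! i') \<inter> sub_verts E (cs ! j) = {}" if "i' < j" for i'
          using sub_verts_children_disjoint[OF T child child, of i' j] that j cs(1)
          by (simp add: nth_eq_iff_index_eq)
        then show ?thesis using root_notin_sub_verts_child[OF T child[OF j]] unfolding P by fastforce
      qed
      then have own: "prefix_cut (sub_edges E (cs ! j)) ?P = prefix_cut (sub_edges E (cs ! j)) (set (take k (Ss ! j)))"
        by (rule prefix_cut_cong[OF sprops(4)[OF j]])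
      have "(\<Sum>c \<in> children E r. prefix_cut (sub_edges E c) ?P) = prefix_cut (sub_edges E (cs ! j)) ?P"
      proof -
        have "prefix_cut (sub_edges E c) ?P = 0" if "c \<in> children E r - {cs ! j}" for c
        proof -
          have "c \<in> set cs" using that cs(2) by blast
          then obtain i where "i < length cs" "c = cs ! i" by (auto simp: in_set_conv_nth)
          then show ?thesis using that other[of i] by auto
        qed
        then show ?thesis
          using sum.remove[OF finite_children[OF T] child[OF j], of "\<lambda>c. prefix_cut (sub_edges E c) ?P"] by simp
      qed
      then have total: "prefix_cut E ?P = card (children E r - ?P) + prefix_cut (sub_edges E (cs ! j)) (set (take k (Ss ! j)))"
        using prefix_cut_decomp[OF T, of ?P] own P by simp
      have early: "cs ! i \<in> ?P" if "i < j" for i unfolding P using that sub_verts_refl by fastforce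
      have late: "card (children E r - ?P) \<le> length cs - j'" if "\<And>i. i < j' \<Longrightarrow> i < length cs \<Longrightarrow> cs ! i \<in> ?P" for j'
      proof -
        have "children E r - ?P \<subseteq> set (drop j' cs)"
        proof
          fix c assume "c \<in> children E r - ?P"
          then have "c \<in> set cs" "c \<notin> ?P" using cs(2) by blast+
          then obtain i where i: "i < length cs" "c = cs ! i" "c \<notin> ?P" by (auto simp: in_set_conv_nth)
          have "\<not> i < j'" using that[of i] i by blast
          then have "j' \<le> i" by simp
          then show "c \<in> set (drop j' cs)" using i by (auto simp: in_set_conv_nth intro!: exI[of _ "i - j'"])
        qed
        then have "card (children E r - ?P) \<le> card (set (drop j' cs))" by (simp add: card_mono)
        also have "\<dots> \<le> length cs - j'" using card_length[of "drop j' cs"] by simp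
        finally show ?thesis .
      qed
      have cb: "length cs \<le> comb ?ds" "?ds ! j + (length cs - Suc j) \<le> comb ?ds"
        using comb_le_iff[of ?ds "comb ?ds"] ds(1) j by auto
      show ?thesis
      \<comment> \<open>At \<open>k = 0\<close> the edge to child \<open>j\<close> may still be
        pending, but no edge inside its subtree is cut, so \<open>length cs\<close> suffices. For
        \<open>k > 0\<close> the child itself is placed, leaving only the edges to the
        \<open>length cs - Suc j\<close> later ones.\<close>
      proof (cases "k = 0")
        case True
        have "card (children E r - ?P) \<le> length cs" using late[of 0] by simp
        then show ?thesis using total True cb(1) by (simp add: prefix_cut_def)
      next
        case False
        have "cs ! j \<in> ?P"
          using serialization_root_first[OF sub[OF j] ser[OF j], of k] False P by blast
        then have "cs ! i \<in> ?P" if "i < Suc j" for i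
          using early that by (cases "i = j") auto
        then have "card (children E r - ?P) \<le> length cs - Suc j" using late[of "Suc j"] by blast
        moreover have "prefix_cut (sub_edges E (cs ! j)) (set (take k (Ss ! j))) \<le> ?ds ! j"
          using prefix_cut_le_dcw_ser[OF sprops(1-4)[OF j]] ds(2)[OF j] by simp
        ultimately show ?thesis using total cb(2) by linarith
      qed
    qed
  qed
  then show "dcw_ser V E (r # concat Ss) \<le> comb ?ds"
    using dcw_ser_le_iff[OF dS setS V EV] by blast
qed

text \<open>By induction, the widths by which the children are ordered are the optimal widths of
  their subtrees, so both bounds are \<open>comb\<close> of the same sorted list. The argument
  covers every admissible order, hence every way of breaking ties.\<close>

lemma standard_serialization_optimal:
  assumes "standard_serialization V E S"
  shows "serialization V E S \<and> dcw V E = dcw_ser V E S"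
  using assms
proof (induction)
  case (single v)
  have S: "serialization {v} {} [v]" by (simp add: serialization_def)
  moreover have "dcw_ser {v} {} [v] = 0" by (simp add: dcw_ser_def)
  ultimately show ?case using dcw_le[OF _ S] by simp
next
  case (branch V E r cs Ss)
  note T = branch.hyps(1)
  have cs: "set cs = children E r" using branch by (simp add: children_def)
  have Ss: "list_all2 (\<lambda>c S. serialization (sub_verts E c) (sub_edges E c) S) cs Ss"
    using branch.IH by (rule list_all2_mono) simp
  have ds: "map2 (\<lambda>c S. dcw_ser (sub_verts E c) (sub_edges E c) S) cs Ss =
      map (\<lambda>c. dcw (sub_verts E c) (sub_edges E c)) cs"
    using branch.IH by (induction rule: list_all2_induct) auto
  note up = concat_serializations[OF T branch.hyps(3) cs Ss]
  have "dcw V E \<in> dcw_ser V E ` {S. serialization V E S}"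
    unfolding dcw_def using up(1) T
    by (intro Min_in finite_imageI finite_serializations) (auto simp: rooted_at_def)
  then obtain S where "serialization V E S" "dcw V E = dcw_ser V E S" by auto
  then have "comb (map (\<lambda>c. dcw (sub_verts E c) (sub_edges E c)) cs) \<le> dcw V E"
    using comb_le_dcw_ser[OF T _ branch.hyps(3) cs] branch.hyps(5) ds by metis
  then have "dcw_ser V E (r # concat Ss) \<le> dcw V E" using up(2) ds by simp
  moreover have "dcw V E \<le> dcw_ser V E (r # concat Ss)"
    using dcw_le[OF _ up(1)] T by (simp add: rooted_at_def)
  ultimately show ?case using up(1) by simp
qed

lemma standard_serialization_exists:
  assumes "rooted_at V E r"
  shows "\<exists>S. standard_serialization V E S"
  using assms
proof (induction "card V" arbitrary: V E r rule: less_induct)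
  case less
  note T = less.prems
  show ?case
  proof (cases "card V = 1")
    case True
    then have "V = {r}" using T by (auto simp: rooted_at_def card_1_singleton_iff)
    moreover have "E = {}" using T \<open>V = {r}\<close> by (auto simp: rooted_at_def)
    ultimately show ?thesis using standard_serialization.single by metis
  next
    case False
    have "\<forall>c \<in> children E r. \<exists>S. standard_serialization (sub_verts E c) (sub_edges E c) S"
      using less.hyps card_sub_verts_child[OF T] rooted_at_subtree[OF T] child_in_V[OF T] by metis
    then obtain F where F: "\<And>c. c \<in> children E r \<Longrightarrow> standard_serialization (sub_verts E c) (sub_edges E c) (F c)"
      by metis
    obtain xs where xs: "distinct xs" "set xs = children E r"
      using finite_distinct_list[OF finite_children[OF T]] by blast
    define d where "d c = dcw_ser (sub_verts E c) (sub_edges E c) (F c)" for c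
    define cs where "cs = sort_key d xs"
    have cs: "distinct cs" "set cs = children E r" "sorted (map d cs)" using xs by (simp_all add: cs_def)
    have "standard_serialization V E (r # concat (map F cs))"
    proof (rule standard_serialization.branch[OF T])
      have "card V > 0" using T by (auto simp: rooted_at_def card_gt_0_iff)
      then show "1 < card V" using False by simp
      show "list_all2 (\<lambda>c S. standard_serialization (sub_verts E c) (sub_edges E c) S) cs (map F cs)"
        using F nth_mem[of _ cs] cs(2) by (simp add: list_all2_conv_all_nth)
      have "map2 (\<lambda>c S. dcw_ser (sub_verts E c) (sub_edges E c) S) cs (map F cs) = map d cs"
        by (simp add: d_def zip_map2 comp_def zip_same_conv_map)
      then show "sorted (map2 (\<lambda>c S. dcw_ser (sub_verts E c) (sub_edges E c) S) cs (map F cs))"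
        using cs(3) by simp
    qed (use cs in \<open>auto simp: children_def\<close>)
    then show ?thesis by blast
  qed
qed

section \<open>The recursion as a function of the set of children\<close>

definition subtree_dcw :: "('a \<times> 'a) set \<Rightarrow> 'a \<Rightarrow> nat" where
  "subtree_dcw E v = dcw (sub_verts E v) (sub_edges E v)"

text \<open>Sorting the multiset of widths makes \<open>comb\<close> independent of how the children
  are listed, so that removed children can be added one at a time.\<close>

definition comb_set :: "('a \<Rightarrow> nat) \<Rightarrow> 'a set \<Rightarrow> nat" where
  "comb_set d A = comb (sorted_list_of_multiset (image_mset d (mset_set A)))"

lemma comb_set_empty [simp]: "comb_set d {} = 0"
  by (simp add: comb_set_def)

text \<open>A width that is not smaller than the earlier ones goes to the end of the sorted list,
  where adding it is one step of the fold. This is the point at which the sweep relies on removing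
  leaves by non-decreasing value.\<close>

lemma comb_set_insert_max:
  assumes "finite A" "x \<notin> A" "\<And>y. y \<in> A \<Longrightarrow> d y \<le> d x"
  shows "comb_set d (insert x A) = max (Suc (comb_set d A)) (d x)"
proof -
  have "insort (d x) (sorted_list_of_multiset (image_mset d (mset_set A))) =
      sorted_list_of_multiset (image_mset d (mset_set A)) @ [d x]"
    using assms by (intro sorted_insort_is_snoc) auto
  then show ?thesis using assms by (simp add: comb_set_def)
qed

lemma dcw_eq_comb_set:
  assumes T: "rooted_at V E r"
  shows "dcw V E = comb_set (subtree_dcw E) (children E r)"
proof -
  obtain xs where xs: "distinct xs" "set xs = children E r"
    using finite_distinct_list[OF finite_children[OF T]] by blast
  define cs where "cs = sort_key (subtree_dcw E) xs"
  have cs: "distinct cs" "set cs = children E r" "sorted (map (subtree_dcw E) cs)"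
    using xs by (simp_all add: cs_def)
  have srt: "sorted_list_of_multiset (image_mset (subtree_dcw E) (mset_set (children E r))) =
      map (subtree_dcw E) cs"
    using cs by (metis mset_map mset_set_set sorted_list_of_multiset_mset sorted_sort_id)
  obtain S where "standard_serialization V E S" using standard_serialization_exists[OF T] by blast
  then have S: "serialization V E S" "dcw V E = dcw_ser V E S"
    using standard_serialization_optimal by blast+
  have lower: "comb (map (subtree_dcw E) cs) \<le> dcw V E"
    using comb_le_dcw_ser[OF T S(1) cs(1,2)] cs(3) S(2) by (simp add: subtree_dcw_def[abs_def])
  have "\<exists>S. standard_serialization (sub_verts E c) (sub_edges E c) S" if "c \<in> children E r" for c
    using standard_serialization_exists rooted_at_subtree[OF T] child_in_V[OF T] that by metis
  then obtain F where F: "\<And>c. c \<in> children E r \<Longrightarrow> standard_serialization (sub_verts E c) (sub_edges E c) (F c)"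
    by metis
  have F': "serialization (sub_verts E c) (sub_edges E c) (F c)"
      "dcw_ser (sub_verts E c) (sub_edges E c) (F c) = subtree_dcw E c" if "c \<in> children E r" for c
    using standard_serialization_optimal[OF F[OF that]] by (simp_all add: subtree_dcw_def)
  have Fs: "list_all2 (\<lambda>c S. serialization (sub_verts E c) (sub_edges E c) S) cs (map F cs)"
    using F'(1) nth_mem[of _ cs] cs(2) by (simp add: list_all2_conv_all_nth)
  have "map2 (\<lambda>c S. dcw_ser (sub_verts E c) (sub_edges E c) S) cs (map F cs) = map (subtree_dcw E) cs"
    using F'(2) cs(2) by (auto simp: zip_map2 comp_def zip_same_conv_map)
  then have "dcw V E \<le> comb (map (subtree_dcw E) cs)"
    using concat_serializations(2)[OF T cs(1,2) Fs]
      dcw_le[OF rooted_at_finite[OF T] concat_serializations(1)[OF T cs(1,2) Fs]] by simp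
  then show ?thesis using lower srt by (simp add: comb_set_def)
qed

text \<open>The equation for a whole tree is applied to the subtree at \<open>v\<close>; the
  subtrees of its children are the same inside \<open>E\<close> and inside
  \<open>sub_edges E v\<close>.\<close>

lemma subtree_dcw_eq:
  assumes T: "rooted_at V E r" and v: "v \<in> V"
  shows "subtree_dcw E v = comb_set (subtree_dcw E) (children E v)"
proof -
  have eq: "subtree_dcw (sub_edges E v) c = subtree_dcw E c" if "c \<in> children E v" for c
  proof -
    have "c \<in> sub_verts E v" using that by (auto simp: children_def sub_verts_def)
    then show ?thesis by (simp add: subtree_dcw_def sub_verts_sub_edges sub_edges_sub_edges)
  qed
  have "image_mset (subtree_dcw (sub_edges E v)) (mset_set (children E v)) =
      image_mset (subtree_dcw E) (mset_set (children E v))"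
    using eq finite_children[OF T] by (intro image_mset_cong) simp
  then show ?thesis
    using dcw_eq_comb_set[OF rooted_at_subtree[OF T v]]
    unfolding subtree_dcw_def[of E v] comb_set_def children_sub_edges by simp
qed

text \<open>Each width is at most its own term in \<open>comb\<close>. This monotonicity towards the
  root is what makes a minimal leaf minimal among all remaining vertices.\<close>

lemma subtree_dcw_child_le:
  assumes T: "rooted_at V E r" and e: "(v, c) \<in> E"
  shows "subtree_dcw E c \<le> subtree_dcw E v"
proof -
  let ?l = "sorted_list_of_multiset (image_mset (subtree_dcw E) (mset_set (children E v)))"
  have "subtree_dcw E c \<in> set ?l"
    using e finite_children[OF T] by (simp add: children_def)
  then obtain i where "i < length ?l" "?l ! i = subtree_dcw E c" by (meson in_set_conv_nth)
  then have "subtree_dcw E c \<le> comb ?l" using comb_le_iff[of ?l "comb ?l"] by fastforce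
  moreover have "v \<in> V" using e T by (auto simp: rooted_at_def)
  ultimately show ?thesis using subtree_dcw_eq[OF T] by (simp add: comb_set_def)
qed

section \<open>The sweep over the tree\<close>

text \<open>An entry is an edge together with the counter of its lower endpoint.\<close>

type_synonym 'a entry = "('a \<times> 'a) \<times> nat"

abbreviation src :: "'a entry \<Rightarrow> 'a" where "src e \<equiv> fst (fst e)"
abbreviation tgt :: "'a entry \<Rightarrow> 'a" where "tgt e \<equiv> snd (fst e)"

text \<open>A remaining leaf of width \<open>d \<ge> k\<close> has the counter
  \<open>Suc d - k\<close>, so a counter of at most 1 means \<open>d = k\<close>.\<close>

definition ready :: "'a entry list \<Rightarrow> 'a entry \<Rightarrow> bool" where
  "ready L e \<longleftrightarrow> snd e \<le> 1 \<and> tgt e \<notin> src ` set L"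

definition remove_leaf :: "'a \<times> 'a \<Rightarrow> 'a entry list \<Rightarrow> 'a entry list" where
  "remove_leaf e L = map (\<lambda>x. (fst x, if tgt x = fst e then Suc (snd x) else snd x))
     (filter (\<lambda>x. tgt x \<noteq> snd e) L)"

definition next_level :: "'a entry list \<Rightarrow> 'a entry list" where
  "next_level L = map (\<lambda>x. (fst x, snd x - 1)) L"

text \<open>Removing a leaf increments at most one counter, and a level change decrements the counter of
  some leaf, so this quantity bounds the number of rounds.\<close>

definition potential :: "'a entry list \<Rightarrow> nat" where
  "potential L = sum_list (map snd L) + 2 * length L"

text \<open>At level \<open>k\<close>, let \<open>m\<close> be the value of \<^const>\<open>comb\<close> on the already removed children of a vertex. Its
  counter is \<open>m + 1 - k\<close>, truncated at \<open>0\<close>: since the child removed at level \<open>k\<close> has width exactly \<open>k\<close>,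
  the update \<open>m := max (m + 1) k\<close> becomes an increment of the truncated counter.\<close>

definition sweep_inv :: "'a set \<Rightarrow> ('a \<times> 'a) set \<Rightarrow> 'a \<Rightarrow> 'a entry list \<Rightarrow> nat \<Rightarrow> nat \<Rightarrow> bool" where
  "sweep_inv V E r L b k \<longleftrightarrow>
     (let F = fst ` set L in
      distinct (map tgt L) \<and> F \<subseteq> E \<and>
      (\<forall>(p, v) \<in> F. p \<noteq> r \<longrightarrow> p \<in> snd ` F) \<and>
      (\<forall>(p, v) \<in> E - F. subtree_dcw E v \<le> k) \<and>
      (\<forall>v \<in> V - snd ` (E - F). k \<le> subtree_dcw E v) \<and>
      (\<forall>e \<in> set L. snd e = Suc (comb_set (subtree_dcw E) (children (E - F) (tgt e))) - k) \<and>
      b = Suc (comb_set (subtree_dcw E) (children (E - F) r)) - k)"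

section \<open>The sweep invariant at the start, at the end and in each round\<close>

lemma sweep_invD:
  assumes "sweep_inv V E r L b k"
  shows "distinct (map tgt L)"
    and "fst ` set L \<subseteq> E"
    and "(p, v) \<in> fst ` set L \<Longrightarrow> p \<noteq> r \<Longrightarrow> p \<in> snd ` fst ` set L"
    and "(p, v) \<in> E - fst ` set L \<Longrightarrow> subtree_dcw E v \<le> k"
    and "v \<in> V \<Longrightarrow> v \<notin> snd ` (E - fst ` set L) \<Longrightarrow> k \<le> subtree_dcw E v"
    and "e \<in> set L \<Longrightarrow> snd e = Suc (comb_set (subtree_dcw E) (children (E - fst ` set L) (tgt e))) - k"
    and "b = Suc (comb_set (subtree_dcw E) (children (E - fst ` set L) r)) - k"
  using assms unfolding sweep_inv_def Let_def by (blast | fast)+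

lemma edge_target_in_V:
  assumes "rooted_at V E r" "(u, v) \<in> E"
  shows "v \<in> V"
  using assms by (auto simp: rooted_at_def)

text \<open>Nothing has been removed, so every value so far is 0 and, at level 0, every counter is
  1. Targets are distinct because parents are unique.\<close>

lemma sweep_inv_init:
  assumes T: "rooted_at V (set es) r" and "distinct es"
  shows "sweep_inv V (set es) r (map (\<lambda>e. (e, 1)) es) 1 0"
proof -
  have "inj_on snd (set es)"
    using rooted_at_unique_parent[OF T] by (auto simp: inj_on_def)
  then have "distinct (map snd es)" using assms(2) by (simp add: distinct_map)
  moreover have "p \<in> snd ` set es" if e: "(p, v) \<in> set es" "p \<noteq> r" for p v
  proof -
    have "p \<in> V - {r}" using e T by (auto simp: rooted_at_def)
    then have "\<exists>!u. (u, p) \<in> set es" using T by (simp add: rooted_at_def)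
    then show ?thesis by force
  qed
  ultimately show ?thesis
    by (auto simp: sweep_inv_def Let_def image_image comp_def children_def)
qed

text \<open>The program builds each new list back to front; the invariant depends only on the set of
  entries and on the distinctness of their targets.\<close>

lemma sweep_inv_rev: "sweep_inv V E r (rev L) b k \<longleftrightarrow> sweep_inv V E r L b k"
  by (simp add: sweep_inv_def rev_map[symmetric])

text \<open>All children of the root have been folded in, so \<open>b\<close> comes from the full
  width; \<open>k \<le> subtree_dcw E r\<close> makes the truncated subtraction exact.\<close>

lemma sweep_inv_final:
  assumes T: "rooted_at V E r" and "sweep_inv V E r [] b k"
  shows "k + (b - 1) = dcw V E"
proof -
  have D: "subtree_dcw E r = dcw V E"
    by (simp add: subtree_dcw_def sub_verts_root[OF T] sub_edges_root[OF T])
  have r: "r \<in> V" "r \<notin> snd ` E" using T by (auto simp: rooted_at_def)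
  have "b = Suc (subtree_dcw E r) - k"
    using sweep_invD(7)[OF assms(2)] subtree_dcw_eq[OF T r(1)] by simp
  moreover have "k \<le> subtree_dcw E r" using sweep_invD(5)[OF assms(2) r(1)] r(2) by simp
  ultimately show ?thesis using D by simp
qed

text \<open>Descending along remaining edges never increases the width, and the descent ends because
  the edge relation is finite and acyclic.\<close>

lemma leaf_below:
  assumes T: "rooted_at V E r" and inv: "sweep_inv V E r L b k" and "(v, c) \<in> fst ` set L"
  shows "\<exists>e \<in> set L. tgt e \<notin> src ` set L \<and> subtree_dcw E (tgt e) \<le> subtree_dcw E c"
proof -
  have "wf (E\<inverse>)"
    using edges_finite[OF T] rooted_at_acyclic[OF T] by (simp add: acyclic_def finite_acyclic_wf_converse)
  then show ?thesis using assms(3)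
  proof (induction c arbitrary: v rule: wf_induct_rule)
    case (less c)
    obtain e where e: "e \<in> set L" "fst e = (v, c)" using less.prems by force
    show ?case
    proof (cases "c \<in> src ` set L")
      case True
      then obtain c' where c': "(c, c') \<in> fst ` set L" by force
      moreover have "(c, c') \<in> E" using sweep_invD(2)[OF inv] c' by blast
      ultimately obtain e where "e \<in> set L" "tgt e \<notin> src ` set L" "subtree_dcw E (tgt e) \<le> subtree_dcw E c'"
        using less.IH[of c' c] by blast
      then show ?thesis using subtree_dcw_child_le[OF T \<open>(c, c') \<in> E\<close>] le_trans by blast
    next
      case False
      then show ?thesis using e by force
    qed
  qed
qed

text \<open>All children of a remaining leaf have been removed, so its counter comes from its full
  width; its own edge remains, so the level has not passed that width.\<close>

lemma leaf_value:
  assumes T: "rooted_at V E r" and inv: "sweep_inv V E r L b k"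
    and e: "e \<in> set L" "tgt e \<notin> src ` set L"
  shows "snd e = Suc (subtree_dcw E (tgt e)) - k" "k \<le> subtree_dcw E (tgt e)"
proof -
  let ?F = "fst ` set L"
  have FE: "?F \<subseteq> E" using sweep_invD(2)[OF inv] .
  have in_F: "fst e \<in> ?F" using e by simp
  then have "(src e, tgt e) \<in> E" using FE by auto
  then have V: "tgt e \<in> V" by (rule edge_target_in_V[OF T])
  have "children (E - ?F) (tgt e) = children E (tgt e)"
    using e(2) by (force simp: children_def)
  then show "snd e = Suc (subtree_dcw E (tgt e)) - k"
    using sweep_invD(6)[OF inv e(1)] subtree_dcw_eq[OF T V] by simp
  have "tgt e \<notin> snd ` (E - ?F)"
  proof
    assume "tgt e \<in> snd ` (E - ?F)"
    then obtain u where u: "(u, tgt e) \<in> E" "(u, tgt e) \<notin> ?F" by auto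
    moreover have "u = src e" using rooted_at_unique_parent[OF T u(1) \<open>(src e, tgt e) \<in> E\<close>] .
    ultimately show False using in_F by simp
  qed
  then show "k \<le> subtree_dcw E (tgt e)" using sweep_invD(5)[OF inv V] by simp
qed

text \<open>From any remaining edge the whole path up to the root remains as well. So the root keeps
  a remaining child while the sweep runs, and a level change can treat it like any inner
  vertex.\<close>

lemma root_in_src:
  assumes T: "rooted_at V E r" and inv: "sweep_inv V E r L b k" and "L \<noteq> []"
  shows "r \<in> src ` set L"
proof -
  let ?F = "fst ` set L"
  have F: "?F \<subseteq> E" "\<And>p v. (p, v) \<in> ?F \<Longrightarrow> p \<noteq> r \<Longrightarrow> p \<in> snd ` ?F"
    using sweep_invD(2,3)[OF inv] by blast+
  have step: "\<exists>w. (r, w) \<in> ?F" if "(r, v) \<in> E\<^sup>*" "(p, v) \<in> ?F" for p v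
    using that
  proof (induction arbitrary: p)
    case base
    then have "(p, r) \<in> E" using F(1) by blast
    then show ?case using T by (simp add: rooted_at_def)
  next
    case (step u v)
    have pu: "p = u" using rooted_at_unique_parent[OF T] F(1) step by blast
    show ?case
    proof (cases "p = r")
      case True
      then show ?thesis using step by blast
    next
      case False
      then obtain q where "(q, p) \<in> ?F" using F(2)[OF step.prems] by force
      then show ?thesis using step.IH pu by blast
    qed
  qed
  have "fst (hd L) \<in> ?F" using \<open>L \<noteq> []\<close> by simp
  then obtain p v where pv: "(p, v) \<in> ?F" by (cases "fst (hd L)") auto
  then have "v \<in> V" using F(1) edge_target_in_V[OF T] by blast
  then have "(r, v) \<in> E\<^sup>*" using T by (simp add: rooted_at_def)
  then obtain w where "(r, w) \<in> ?F" using step pv by blast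
  then show ?thesis by force
qed

text \<open>Without a ready entry every remaining leaf is wider than \<open>k\<close>, and by
  monotonicity so is every vertex above one, the root included; hence the level may rise. Lowering a
  counter by one agrees with the truncation. Some remaining leaf has a counter of at least 2, so the
  potential drops.\<close>

lemma sweep_inv_next_level:
  assumes T: "rooted_at V E r" and inv: "sweep_inv V E r L b k" and "L \<noteq> []"
    and none: "\<And>e. e \<in> set L \<Longrightarrow> \<not> ready L e"
  shows "sweep_inv V E r (next_level L) (b - 1) (Suc k)"
    and "potential (next_level L) < potential L"
proof -
  let ?F = "fst ` set L"
  have F: "fst ` set (next_level L) = ?F" "map tgt (next_level L) = map tgt L"
    by (auto simp: next_level_def image_image)
  have leaf: "Suc k \<le> subtree_dcw E (tgt e)" "2 \<le> snd e" if "e \<in> set L" "tgt e \<notin> src ` set L" for e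
    using none[OF that(1)] that(2) leaf_value[OF T inv that] by (auto simp: ready_def)
  have grow: "Suc k \<le> subtree_dcw E v" if v: "v \<in> V - snd ` (E - ?F)" for v
  proof (cases "v \<in> src ` set L")
    case True
    then obtain c where c: "(v, c) \<in> ?F" by force
    then obtain e where "e \<in> set L" "tgt e \<notin> src ` set L" "subtree_dcw E (tgt e) \<le> subtree_dcw E c"
      using leaf_below[OF T inv] by blast
    moreover have "(v, c) \<in> E" using c sweep_invD(2)[OF inv] by blast
    ultimately show ?thesis using leaf(1)[of e] subtree_dcw_child_le[OF T, of v c] by simp
  next
    case False
    then have "v \<noteq> r" using root_in_src[OF T inv \<open>L \<noteq> []\<close>] by blast
    then have "\<exists>!u. (u, v) \<in> E" using v T by (simp add: rooted_at_def)
    then obtain u where "(u, v) \<in> E" by blast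
    then have "(u, v) \<in> ?F" using v by force
    then obtain e where "e \<in> set L" "tgt e = v" by force
    then show ?thesis using leaf(1) False by blast
  qed
  show "sweep_inv V E r (next_level L) (b - 1) (Suc k)"
    unfolding sweep_inv_def Let_def F
  proof (intro conjI)
    show "distinct (map tgt L)" "?F \<subseteq> E" using sweep_invD(1,2)[OF inv] .
    show "\<forall>(p, v) \<in> ?F. p \<noteq> r \<longrightarrow> p \<in> snd ` ?F" using sweep_invD(3)[OF inv] by blast
    show "\<forall>(p, v) \<in> E - ?F. subtree_dcw E v \<le> Suc k" using sweep_invD(4)[OF inv] le_SucI by blast
    show "\<forall>v \<in> V - snd ` (E - ?F). Suc k \<le> subtree_dcw E v" using grow by blast
    show "\<forall>e \<in> set (next_level L). snd e =
        Suc (comb_set (subtree_dcw E) (children (E - ?F) (tgt e))) - Suc k"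
    proof
      fix e assume "e \<in> set (next_level L)"
      then obtain y where "y \<in> set L" "fst e = fst y" "snd e = snd y - 1" by (auto simp: next_level_def)
      then show "snd e = Suc (comb_set (subtree_dcw E) (children (E - ?F) (tgt e))) - Suc k"
        using sweep_invD(6)[OF inv, of y] by simp
    qed
    show "b - 1 = Suc (comb_set (subtree_dcw E) (children (E - ?F) r)) - Suc k"
      using sweep_invD(7)[OF inv] by simp
  qed
  obtain x where "x \<in> set L" using \<open>L \<noteq> []\<close> by (cases L) auto
  then obtain e where e: "e \<in> set L" "tgt e \<notin> src ` set L"
    using leaf_below[OF T inv, of "src x" "tgt x"] by auto
  have "sum_list (map snd (next_level L)) < sum_list (map snd L)"
    unfolding next_level_def map_map using leaf(2)[OF e] e(1)
  proof (induction L)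
    case (Cons y L)
    have le: "sum_list (map (snd \<circ> (\<lambda>x. (fst x, snd x - 1))) L) \<le> sum_list (map snd L)"
      by (intro sum_list_mono) auto
    show ?case
    proof (cases "e = y")
      case True
      then show ?thesis using Cons.prems le by (simp add: comp_def)
    next
      case False
      then show ?thesis using Cons by simp
    qed
  qed simp
  then show "potential (next_level L) < potential L" by (simp add: potential_def next_level_def)
qed

text \<open>The removed leaf has width exactly \<open>k\<close> and the earlier ones at most
  \<open>k\<close>, so the value \<open>m\<close> of its parent becomes
  \<open>max (Suc m) k\<close>. On the truncated counter this is a plain \<open>Suc\<close>: if
  \<open>Suc m \<le> k\<close>, the counter goes from 0 to \<open>Suc k - k = 1\<close>.\<close>

lemma sweep_inv_remove_leaf:
  assumes T: "rooted_at V E r" and inv: "sweep_inv V E r L b k"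
    and e: "e \<in> set L" "ready L e"
  shows "sweep_inv V E r (remove_leaf (fst e) L) (if src e \<in> tgt ` set L then b else Suc b) k"
    and "potential (remove_leaf (fst e) L) < potential L"
proof -
  let ?D = "subtree_dcw E"
  define p v where "p = src e" and "v = tgt e"
  let ?F = "fst ` set L" and ?L = "remove_leaf (p, v) L"
  have FE: "?F \<subseteq> E" using sweep_invD(2)[OF inv] .
  have pv: "(p, v) \<in> ?F" using e(1) by (simp add: p_def v_def)
  have fst_e: "fst e = (p, v)" by (simp add: p_def v_def)
  have leaf: "v \<notin> fst ` ?F" using e(2) by (auto simp: ready_def v_def image_image)
  have Dv: "?D v = k"
    using leaf_value[OF T inv e(1)] e(2) by (auto simp: ready_def v_def)
  have par: "q = p" if "(q, v) \<in> E" for q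
    using rooted_at_unique_parent[OF T that] pv FE by blast
  have F': "fst ` set ?L = ?F - {(p, v)}"
  proof -
    have "fst ` set ?L = {f \<in> ?F. snd f \<noteq> v}" by (force simp: remove_leaf_def)
    also have "\<dots> = ?F - {(p, v)}" using par FE by auto
    finally show ?thesis .
  qed
  have EF: "E - (?F - {(p, v)}) = insert (p, v) (E - ?F)" using pv FE by blast
  have ch: "children (insert (p, v) (E - ?F)) u =
      (if u = p then insert v (children (E - ?F) p) else children (E - ?F) u)" for u
    by (auto simp: children_def)
  have removed: "?D c \<le> k" if "(q, c) \<in> E - ?F" for q c
    using sweep_invD(4)[OF inv that] .
  have comb: "comb_set ?D (insert v (children (E - ?F) p)) = max (Suc (comb_set ?D (children (E - ?F) p))) k"
  proof -
    have "finite (children (E - ?F) p)"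
      using finite_children[OF T, of p] by (rule rev_finite_subset) (auto simp: children_def)
    moreover have "v \<notin> children (E - ?F) p" using pv by (simp add: children_def)
    ultimately show ?thesis
      using comb_set_insert_max[of "children (E - ?F) p" v ?D] removed Dv by (simp add: children_def)
  qed
  have r_no_tgt: "r \<notin> tgt ` set L"
  proof
    assume "r \<in> tgt ` set L"
    then obtain x where "x \<in> set L" "r = tgt x" by blast
    then have "(src x, r) \<in> E" using FE by auto
    then show False using T by (simp add: rooted_at_def)
  qed
  \<comment> \<open>A source that is the target of no remaining edge must be the root; the program
    can therefore recognize the root without storing it.\<close>
  have b_cond: "src e \<in> tgt ` set L \<longleftrightarrow> p \<noteq> r"
    using sweep_invD(3)[OF inv pv] r_no_tgt by (auto simp: p_def image_image)
  show "sweep_inv V E r (remove_leaf (fst e) L) (if src e \<in> tgt ` set L then b else Suc b) k"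
    unfolding b_cond unfolding sweep_inv_def Let_def fst_e F' EF
  proof (intro conjI)
    show "distinct (map tgt ?L)"
      using sweep_invD(1)[OF inv] by (simp add: remove_leaf_def comp_def distinct_map_filter)
    show "?F - {(p, v)} \<subseteq> E" using FE by blast
    have "q \<in> snd ` (?F - {(p, v)})" if q: "(q, w) \<in> ?F - {(p, v)}" "q \<noteq> r" for q w
    proof -
      have "q \<in> snd ` ?F" using sweep_invD(3)[OF inv] q by blast
      moreover have "q \<noteq> v" using leaf q by force
      ultimately show ?thesis by force
    qed
    then show "\<forall>(q, w) \<in> ?F - {(p, v)}. q \<noteq> r \<longrightarrow> q \<in> snd ` (?F - {(p, v)})" by blast
    show "\<forall>(q, c) \<in> insert (p, v) (E - ?F). ?D c \<le> k" using removed Dv by auto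
    show "\<forall>u \<in> V - snd ` insert (p, v) (E - ?F). k \<le> ?D u"
      using sweep_invD(5)[OF inv] by auto
    show "\<forall>x \<in> set ?L. snd x = Suc (comb_set ?D (children (insert (p, v) (E - ?F)) (tgt x))) - k"
    proof
      fix x assume "x \<in> set ?L"
      then obtain y where y: "y \<in> set L" "fst x = fst y" "snd x = (if tgt y = p then Suc (snd y) else snd y)"
        by (auto simp: remove_leaf_def)
      have "snd y = Suc (comb_set ?D (children (E - ?F) (tgt y))) - k"
        using sweep_invD(6)[OF inv y(1)] .
      then show "snd x = Suc (comb_set ?D (children (insert (p, v) (E - ?F)) (tgt x))) - k"
        using y(2,3) by (auto simp: ch comb max_def)
    qed
    have "b = Suc (comb_set ?D (children (E - ?F) r)) - k" using sweep_invD(7)[OF inv] .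
    then show "(if p \<noteq> r then b else Suc b) = Suc (comb_set ?D (children (insert (p, v) (E - ?F)) r)) - k"
      using comb ch[of r] by (cases "p = r") (auto simp: max_def)
  qed
  let ?K = "filter (\<lambda>x. tgt x \<noteq> v) L"
  \<comment> \<open>Targets are distinct, so at most one counter is incremented.\<close>
  have "sum_list (map (\<lambda>x. if tgt x = p then Suc (snd x) else snd x) M) \<le> Suc (sum_list (map snd M))"
    if "distinct (map tgt M)" for M :: "'a entry list"
    using that
  proof (induction M)
    case (Cons y M)
    show ?case
    proof (cases "tgt y = p")
      case True
      then have "p \<notin> tgt ` set M" using Cons.prems by simp
      then have "tgt x \<noteq> p" if "x \<in> set M" for x using that by blast
      then have eq: "map (\<lambda>x. if tgt x = p then Suc (snd x) else snd x) M = map snd M" by auto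
      show ?thesis using True by (simp add: eq del: map_eq_conv)
    qed (use Cons in simp)
  qed simp
  then have "sum_list (map snd ?L) \<le> Suc (sum_list (map snd ?K))"
    using sweep_invD(1)[OF inv] by (simp add: remove_leaf_def comp_def distinct_map_filter)
  moreover have "sum_list (map snd ?K) \<le> sum_list (map snd L)" by (induction L) auto
  moreover have "length ?K < length L"
    using e(1) by (intro length_filter_less[of e]) (auto simp: v_def)
  ultimately have "potential ?L < potential L" by (simp add: potential_def remove_leaf_def)
  then show "potential (remove_leaf (fst e) L) < potential L" by (simp add: p_def v_def)
qed

section \<open>Timed execution of WHILE programs\<close>

definition runs :: "com \<Rightarrow> store \<Rightarrow> nat \<Rightarrow> (store \<Rightarrow> bool) \<Rightarrow> bool" where
  "runs c s B Q \<longleftrightarrow> (\<exists>t s'. exec c s t s' \<and> t \<le> B \<and> Q s')"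

lemma runs_le: "runs c s B' Q \<Longrightarrow> B' \<le> B \<Longrightarrow> runs c s B Q"
  unfolding runs_def using le_trans by blast

lemma runs_conseq: "runs c s B P \<Longrightarrow> (\<And>s'. P s' \<Longrightarrow> Q s') \<Longrightarrow> runs c s B Q"
  unfolding runs_def by blast

lemma runs_Skip: "Q s \<Longrightarrow> runs Skip s 1 Q"
  unfolding runs_def by (intro exI conjI, rule exec.Skip) auto

lemma runs_Assign: "Q (s(x := eval_expr a s)) \<Longrightarrow> runs (Assign x a) s (1 + expr_time a) Q"
  unfolding runs_def by (intro exI conjI, rule exec.Assign) auto

lemma runs_Seq:
  assumes "runs c s B (\<lambda>s'. runs c' s' B' Q)"
  shows "runs (Seq c c') s (1 + B + B') Q"
proof -
  obtain t s' where 1: "exec c s t s'" "t \<le> B" "runs c' s' B' Q" using assms by (auto simp: runs_def)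
  then obtain t' s'' where 2: "exec c' s' t' s''" "t' \<le> B'" "Q s''" by (auto simp: runs_def)
  show ?thesis unfolding runs_def
    using exec.Seq[OF 1(1) 2(1)] 1(2) 2(2,3) by (intro exI conjI) auto
qed

text \<open>The budgets of the branches are added instead of maximised: time bounds stay plain sums,
  at the price of harmless slack.\<close>

lemma runs_Cond:
  assumes "eval_expr a s \<noteq> NIL \<Longrightarrow> runs c s B Q" "eval_expr a s = NIL \<Longrightarrow> runs c' s B' Q"
  shows "runs (Cond a c c') s (1 + expr_time a + B + B') Q"
proof (cases "eval_expr a s = NIL")
  case True
  then obtain t s' where t: "exec c' s t s'" "t \<le> B'" "Q s'" using assms(2) by (auto simp: runs_def)
  show ?thesis unfolding runs_def
    using exec.CondFalse[OF True t(1)] t(2,3) by (intro exI conjI) auto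
next
  case False
  then obtain t s' where t: "exec c s t s'" "t \<le> B" "Q s'" using assms(1) by (auto simp: runs_def)
  show ?thesis unfolding runs_def
    using exec.CondTrue[OF False t(1)] t(2,3) by (intro exI conjI) auto
qed

lemma runs_While_False:
  "eval_expr a s = NIL \<Longrightarrow> Q s \<Longrightarrow> runs (While a c) s (1 + expr_time a) Q"
  unfolding runs_def by (intro exI conjI, erule exec.WhileFalse) auto

lemma runs_While_True:
  assumes "eval_expr a s \<noteq> NIL" "runs c s B (\<lambda>s'. runs (While a c) s' B' Q)"
  shows "runs (While a c) s (1 + expr_time a + B + B') Q"
proof -
  obtain t s' where 1: "exec c s t s'" "t \<le> B" "runs (While a c) s' B' Q"
    using assms(2) by (auto simp: runs_def)
  then obtain t' s'' where 2: "exec (While a c) s' t' s''" "t' \<le> B'" "Q s''" by (auto simp: runs_def)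
  show ?thesis unfolding runs_def
    using exec.WhileTrue[OF assms(1) 1(1) 2(1)] 1(2) 2(2,3) by (intro exI conjI) auto
qed

lemmas wp = runs_Skip runs_Assign runs_Seq runs_Cond

text \<open>The invariant carries the measure as an index. At most \<open>n\<close> rounds take
  place, and \<open>Suc n\<close> also pays for the final, failing test.\<close>

lemma runs_While_measure:
  assumes "I n s"
    and step: "\<And>n s. I n s \<Longrightarrow> eval_expr a s \<noteq> NIL \<Longrightarrow> runs c s B (\<lambda>s'. \<exists>m < n. I m s')"
  shows "runs (While a c) s (Suc n * (1 + expr_time a + B)) (\<lambda>s'. \<exists>n. I n s' \<and> eval_expr a s' = NIL)"
    (is "runs _ _ _ ?Q")
  using assms(1)
proof (induction n arbitrary: s rule: less_induct)
  case (less n)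
  let ?k = "1 + expr_time a + B"
  show ?case
  proof (cases "eval_expr a s = NIL")
    case True
    show ?thesis
      by (rule runs_le[OF runs_While_False[of a s]]) (use less.prems True in auto)
  next
    case False
    have "runs c s B (\<lambda>s'. runs (While a c) s' (n * ?k) ?Q)"
    proof (rule runs_conseq[OF step[OF less.prems False]])
      fix s' assume "\<exists>m < n. I m s'"
      then obtain m where m: "m < n" "I m s'" by blast
      have "Suc m * ?k \<le> n * ?k" using m(1) by (intro mult_le_mono1) simp
      then show "runs (While a c) s' (n * ?k) ?Q" by (rule runs_le[OF less.IH[OF m]])
    qed
    from runs_While_True[OF False this] show ?thesis by (simp add: algebra_simps)
  qed
qed

primrec assigned :: "com \<Rightarrow> nat set" where
  "assigned Skip = {}"
| "assigned (Assign x a) = {x}"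
| "assigned (Seq c c') = assigned c \<union> assigned c'"
| "assigned (Cond a c c') = assigned c \<union> assigned c'"
| "assigned (While a c) = assigned c"

lemma exec_frame: "exec c s t s' \<Longrightarrow> x \<notin> assigned c \<Longrightarrow> s' x = s x"
  by (induction rule: exec.induct) auto

lemma runs_frame:
  assumes "runs c s B P" "\<And>s'. P s' \<Longrightarrow> (\<And>x. x \<notin> assigned c \<Longrightarrow> s' x = s x) \<Longrightarrow> Q s'"
  shows "runs c s B Q"
proof -
  obtain t s' where t: "exec c s t s'" "t \<le> B" "P s'" using assms(1) by (auto simp: runs_def)
  then have "Q s'" using assms(2) exec_frame[OF t(1)] by blast
  then show ?thesis using t by (auto simp: runs_def)
qed

lemma enc_list_simps [simp]:
  "enc_list f [] = NIL" "enc_list f (x # xs) = PAIR (f x) (enc_list f xs)"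
  by (simp_all add: enc_list_def)

lemma enc_unary_simps [simp]:
  "enc_unary 0 = NIL" "enc_unary (Suc n) = PAIR NIL (enc_unary n)"
  by (simp_all add: enc_unary_def)

lemma sexp_tl_enc_unary [simp]: "sexp_tl (enc_unary n) = enc_unary (n - 1)"
  by (cases n) auto

lemma enc_unary_eq_NIL_iff [simp]: "enc_unary n = NIL \<longleftrightarrow> n = 0"
  by (cases n) auto

lemma enc_list_eq_NIL_iff [simp]: "enc_list f xs = NIL \<longleftrightarrow> xs = []"
  by (cases xs) auto

definition enc_entry :: "word entry \<Rightarrow> sexp" where
  "enc_entry e = PAIR (enc_edge (fst e)) (enc_unary (snd e))"

lemma enc_entry_simps [simp]:
  "sexp_hd (sexp_hd (enc_entry e)) = enc_word (src e)"
  "sexp_tl (sexp_hd (enc_entry e)) = enc_word (tgt e)"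
  "sexp_hd (enc_entry e) = enc_edge (fst e)"
  "sexp_tl (enc_entry e) = enc_unary (snd e)"
  "enc_entry e \<noteq> NIL"
  by (simp_all add: enc_entry_def enc_edge_def)

lemma enc_edge_simps [simp]:
  "sexp_hd (enc_edge e) = enc_word (fst e)" "sexp_tl (enc_edge e) = enc_word (snd e)"
  by (simp_all add: enc_edge_def)

definition foreach :: "nat \<Rightarrow> com \<Rightarrow> com" where
  "foreach y c = While (Var y) (Seq c (Assign y (Tl (Var y))))"

lemma assigned_foreach [simp]: "assigned (foreach y c) = insert y (assigned c)"
  by (auto simp: foreach_def)

text \<open>The invariant refers to the processed part \<open>zs\<close> and is evaluated after
  \<open>y\<close> has moved past \<open>x\<close>. A round costs 6 steps besides the body: 2 for
  the test, 1 for sequencing, 3 for advancing \<open>y\<close>; the last 2 are the failing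
  test.\<close>

lemma runs_foreach:
  assumes "s y = enc_list f xs" "I [] s" "length xs \<le> n"
    and step: "\<And>zs x xs' s. xs = zs @ x # xs' \<Longrightarrow> I zs s \<Longrightarrow> s y = PAIR (f x) (enc_list f xs') \<Longrightarrow>
      runs c s B (\<lambda>s'. s' y = PAIR (f x) (enc_list f xs') \<and> I (zs @ [x]) (s'(y := enc_list f xs')))"
  shows "runs (foreach y c) s (n * (B + 6) + 2) (I xs)"
proof -
  have gen: "runs (foreach y c) s (length ys * (B + 6) + 2) (I xs)"
    if "xs = zs @ ys" "I zs s" "s y = enc_list f ys" for zs ys s
    using that
  proof (induction ys arbitrary: zs s)
    case Nil
    then show ?case unfolding foreach_def
      by (intro runs_le[OF runs_While_False]) auto
  next
    case (Cons x ys)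
    show ?case unfolding foreach_def
    proof (rule runs_le[OF runs_While_True])
      show "eval_expr (Var y) s \<noteq> NIL" using Cons.prems by simp
      show "runs (Seq c (Assign y (Tl (Var y)))) s (1 + B + (1 + expr_time (Tl (Var y))))
          (\<lambda>s'. runs (While (Var y) (Seq c (Assign y (Tl (Var y))))) s' (length ys * (B + 6) + 2) (I xs))"
      proof (intro runs_Seq runs_conseq[OF step[OF Cons.prems(1,2)]])
        show "s y = PAIR (f x) (enc_list f ys)" using Cons.prems by simp
        fix s' assume s': "s' y = PAIR (f x) (enc_list f ys) \<and> I (zs @ [x]) (s'(y := enc_list f ys))"
        have "runs (foreach y c) (s'(y := enc_list f ys)) (length ys * (B + 6) + 2) (I xs)"
        proof (rule Cons.IH[of "zs @ [x]"])
          show "xs = (zs @ [x]) @ ys" using Cons.prems by simp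
          show "I (zs @ [x]) (s'(y := enc_list f ys))" by (rule conjunct2[OF s'])
        qed simp
        moreover have "eval_expr (Tl (Var y)) s' = enc_list f ys" using s' by simp
        ultimately show "runs (Assign y (Tl (Var y))) s' (1 + expr_time (Tl (Var y)))
          (\<lambda>s'. runs (While (Var y) (Seq c (Assign y (Tl (Var y))))) s' (length ys * (B + 6) + 2) (I xs))"
          by (intro runs_Assign) (simp only: foreach_def)
      qed
    qed simp
  qed
  have "runs (foreach y c) s (length xs * (B + 6) + 2) (I xs)"
    by (rule gen[of "[]"]) (simp_all add: assms(1,2))
  moreover have "length xs * (B + 6) \<le> n * (B + 6)" using assms(3) by (rule mult_le_mono1)
  ultimately show ?thesis using runs_le by simp
qed

definition NILC :: expr where "NILC = Const NIL"
definition TRUEC :: expr where "TRUEC = Const (PAIR NIL NIL)"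

lemma const_simps [simp]:
  "eval_expr NILC s = NIL" "eval_expr TRUEC s = PAIR NIL NIL"
  "expr_time NILC = 1" "expr_time TRUEC = 1"
  by (simp_all add: NILC_def TRUEC_def)

section \<open>The program\<close>

text \<open>Variables: \<open>1\<close> holds the remaining entries, \<open>2\<close> the count of the root, \<open>3\<close> the level; \<open>7\<close> is
  the picked leaf, \<open>8\<close> a flag, \<open>6\<close> the list under construction, \<open>4\<close> and \<open>5\<close> are loop variables, and
  \<open>11\<close> receives the result of comparing the words in \<open>9\<close> and \<open>10\<close>.\<close>

definition eq_loop :: com where
  "eq_loop = While (Var 9) (Seq
     (Cond (Var 10)
       (Cond (Hd (Var 9))
         (Cond (Hd (Var 10)) Skip (Assign 11 NILC))
         (Cond (Hd (Var 10)) (Assign 11 NILC) Skip))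
       (Assign 11 NILC))
     (Seq (Assign 10 (Tl (Var 10))) (Assign 9 (Tl (Var 9)))))"

text \<open>The loop ends with the first word, so a nonempty rest of the second one still has to
  clear the result.\<close>

definition eq_com :: com where
  "eq_com = Seq (Assign 11 TRUEC) (Seq eq_loop (Cond (Var 10) (Assign 11 NILC) Skip))"

text \<open>The result is only ever cleared, never set, so its initial value is part of the claim;
  this makes the claim inductive in the remaining suffixes.\<close>

lemma runs_eq_loop:
  assumes "s 9 = enc_word x" "s 10 = enc_word y"
  shows "runs eq_loop s (40 * length x + 2)
    (\<lambda>s'. (s' 11 \<noteq> NIL \<and> s' 10 = NIL) \<longleftrightarrow> (s 11 \<noteq> NIL \<and> x = y))"
  using assms
proof (induction x arbitrary: y s)
  case Nil
  then show ?case unfolding eq_loop_def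
    by (intro runs_le[OF runs_While_False]) (auto simp: enc_word_def)
next
  case (Cons a x)
  let ?b = "case y of [] \<Rightarrow> False | b # _ \<Rightarrow> a = b"
  \<comment> \<open>The store after one round. If \<open>y\<close> is exhausted, \<open>?b\<close>
    is false and the result is cleared, while \<open>tl y\<close> stays empty just as
    \<open>Tl\<close> keeps \<open>NIL\<close>.\<close>
  let ?s = "s(11 := if ?b then s 11 else NIL, 10 := enc_word (tl y), 9 := enc_word x)"
  have IH: "runs eq_loop ?s (40 * length x + 2)
      (\<lambda>s'. (s' 11 \<noteq> NIL \<and> s' 10 = NIL) \<longleftrightarrow> (?s 11 \<noteq> NIL \<and> x = tl y))"
    by (rule Cons.IH) auto
  have IH': "runs eq_loop ?s (40 * length x + 2)
      (\<lambda>s'. (s' 11 \<noteq> NIL \<and> s' 10 = NIL) \<longleftrightarrow> (s 11 \<noteq> NIL \<and> a # x = y))"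
    by (rule runs_conseq[OF IH]) (auto split: list.splits)
  have IH'': "runs eq_loop s'' (40 * length x + 2)
      (\<lambda>s'. (s' 11 \<noteq> NIL \<and> s' 10 = NIL) \<longleftrightarrow> (s 11 \<noteq> NIL \<and> a # x = y))" if "s'' = ?s" for s''
    using IH' that by simp
  show ?case
    apply (subst eq_loop_def)
    apply (rule runs_le)
     apply (rule runs_While_True)
      apply (use Cons.prems in \<open>simp add: enc_word_def\<close>)
     apply (fold eq_loop_def)
     apply ((rule wp | rule IH'', (use Cons.prems in
        \<open>auto simp: enc_word_def enc_bool_def fun_eq_iff split: list.splits if_splits\<close>)[1])+)
    apply simp
    done
qed

text \<open>Like the other bounds of this kind, a rounded-up step count in one size parameter
  \<open>M\<close>; only polynomial growth matters.\<close>

definition t_eq :: "nat \<Rightarrow> nat" where "t_eq M = 40 * M + 20"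

lemma assigned_eq_com [simp]: "assigned eq_com = {9, 10, 11}"
  by (auto simp: eq_com_def eq_loop_def)

lemma runs_eq_com:
  assumes "s 9 = enc_word x" "s 10 = enc_word y" "length x \<le> M"
    and "\<And>s'. s' 11 \<noteq> NIL \<longleftrightarrow> x = y \<Longrightarrow> (\<And>v. v \<notin> {9, 10, 11} \<Longrightarrow> s' v = s v) \<Longrightarrow> Q s'"
  shows "runs eq_com s (t_eq M) Q"
proof (rule runs_frame[where P = "\<lambda>s'. s' 11 \<noteq> NIL \<longleftrightarrow> x = y"])
  let ?s = "s(11 := PAIR NIL NIL)"
  have loop: "runs eq_loop ?s (40 * length x + 2)
    (\<lambda>s'. (s' 11 \<noteq> NIL \<and> s' 10 = NIL) \<longleftrightarrow> (?s 11 \<noteq> NIL \<and> x = y))"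
    using assms by (intro runs_eq_loop) auto
  show "runs eq_com s (t_eq M) (\<lambda>s'. s' 11 \<noteq> NIL \<longleftrightarrow> x = y)"
    unfolding eq_com_def
    apply (rule runs_le)
     apply (rule wp)+
     apply simp
     apply (rule runs_conseq[OF loop])
     apply (rule runs_Cond; rule wp)
    using assms(3) by (auto simp: t_eq_def)
qed (use assms(4) in auto)

definition leaf_com :: com where
  "leaf_com = Seq (Assign 8 TRUEC) (Seq (Assign 5 (Var 1)) (foreach 5
     (Seq (Assign 9 (Hd (Hd (Hd (Var 5))))) (Seq (Assign 10 (Tl (Hd (Hd (Var 4)))))
     (Seq eq_com (Cond (Var 11) (Assign 8 NILC) Skip))))))"

definition t_leaf :: "nat \<Rightarrow> nat" where "t_leaf M = M * (t_eq M + 40) + 20"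

lemma assigned_leaf_com [simp]: "assigned leaf_com = {5, 8, 9, 10, 11}"
  by (auto simp: leaf_com_def)

definition bounded :: "nat \<Rightarrow> word entry list \<Rightarrow> bool" where
  "bounded M L \<longleftrightarrow> length L \<le> M \<and> (\<forall>e \<in> set L. length (src e) \<le> M \<and> length (tgt e) \<le> M)"

lemma runs_leaf_com:
  assumes "s 1 = enc_list enc_entry L" "s 4 = PAIR (enc_entry e) d" "bounded M L"
    and Q: "\<And>s'. s' 8 \<noteq> NIL \<longleftrightarrow> tgt e \<notin> src ` set L \<Longrightarrow>
      (\<And>v. v \<notin> {5, 8, 9, 10, 11} \<Longrightarrow> s' v = s v) \<Longrightarrow> Q s'"
  shows "runs leaf_com s (t_leaf M) Q"
proof (rule runs_frame[where P = "\<lambda>s'. s' 8 \<noteq> NIL \<longleftrightarrow> tgt e \<notin> src ` set L"])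
  let ?s = "s(8 := PAIR NIL NIL, 5 := enc_list enc_entry L)"
  let ?I = "\<lambda>zs s'. s' 4 = s 4 \<and> (s' 8 \<noteq> NIL \<longleftrightarrow> tgt e \<notin> src ` set zs)"
  let ?c = "Seq (Assign 9 (Hd (Hd (Hd (Var 5))))) (Seq (Assign 10 (Tl (Hd (Hd (Var 4)))))
     (Seq eq_com (Cond (Var 11) (Assign 8 NILC) Skip)))"
  have loop: "runs (foreach 5 ?c) ?s (M * (t_eq M + 30 + 6) + 2) (?I L)"
  proof (rule runs_foreach[where f = enc_entry and I = ?I and xs = L])
    fix zs x xs' and s' :: store
    assume L: "L = zs @ x # xs'" and I: "?I zs s'" and s5: "s' 5 = PAIR (enc_entry x) (enc_list enc_entry xs')"
    have x: "length (src x) \<le> M" using L assms(3) by (auto simp: bounded_def)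
    show "runs ?c s' (t_eq M + 30) (\<lambda>s'. s' 5 = PAIR (enc_entry x) (enc_list enc_entry xs') \<and>
      ?I (zs @ [x]) (s'(5 := enc_list enc_entry xs')))"
      apply (rule runs_le)
       apply (rule wp)+
       apply (rule runs_eq_com[where x = "src x" and y = "tgt e" and M = M])
          apply (use s5 I assms(1-3) x in simp_all)
      apply (rule runs_Cond; rule wp)
      apply auto
      done
  qed (use assms(1-3) in \<open>auto simp: bounded_def\<close>)
  show "runs leaf_com s (t_leaf M) (\<lambda>s'. s' 8 \<noteq> NIL \<longleftrightarrow> tgt e \<notin> src ` set L)"
    unfolding leaf_com_def
    apply (rule runs_le)
     apply (rule wp)+
     apply (use assms(1) in simp)
     apply (rule runs_conseq[OF loop])
     apply (simp_all add: t_leaf_def algebra_simps)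
    done
qed (use Q in auto)

definition pick_com :: com where
  "pick_com = Seq (Assign 7 NILC) (Seq (Assign 4 (Var 1)) (foreach 4
     (Cond (Tl (Tl (Hd (Var 4)))) Skip
       (Seq leaf_com (Cond (Var 8) (Assign 7 (Hd (Var 4))) Skip)))))"

definition t_pick :: "nat \<Rightarrow> nat" where "t_pick M = M * (t_leaf M + 40) + 20"

lemma assigned_pick_com [simp]: "assigned pick_com = {4, 5, 7, 8, 9, 10, 11}"
  by (auto simp: pick_com_def)

text \<open>\<open>NIL\<close> encodes no entry and so signals that none is ready. The scan runs
  through the whole list and keeps the last hit; the choice is left open since the sweep accepts any
  ready entry.\<close>

definition picked :: "word entry list \<Rightarrow> sexp \<Rightarrow> bool" where
  "picked L d \<longleftrightarrow> (d = NIL \<and> (\<forall>e \<in> set L. \<not> ready L e)) \<or> (\<exists>e \<in> set L. ready L e \<and> d = enc_entry e)"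

lemma runs_pick_com:
  assumes "s 1 = enc_list enc_entry L" "bounded M L"
    and Q: "\<And>s'. picked L (s' 7) \<Longrightarrow>
      (\<And>v. v \<notin> {4, 5, 7, 8, 9, 10, 11} \<Longrightarrow> s' v = s v) \<Longrightarrow> Q s'"
  shows "runs pick_com s (t_pick M) Q"
proof (rule runs_frame[where P = "\<lambda>s'. picked L (s' 7)"])
  let ?s = "s(7 := NIL, 4 := enc_list enc_entry L)"
  let ?I = "\<lambda>zs s'. s' 1 = s 1 \<and> ((s' 7 = NIL \<and> (\<forall>e \<in> set zs. \<not> ready L e)) \<or>
     (\<exists>e \<in> set zs. ready L e \<and> s' 7 = enc_entry e))"
  let ?c = "Cond (Tl (Tl (Hd (Var 4)))) Skip
       (Seq leaf_com (Cond (Var 8) (Assign 7 (Hd (Var 4))) Skip))"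
  have loop: "runs (foreach 4 ?c) ?s (M * (t_leaf M + 30 + 6) + 2) (?I L)"
  proof (rule runs_foreach[where f = enc_entry and I = ?I and xs = L])
    fix zs x xs' and s' :: store
    assume L: "L = zs @ x # xs'" and I: "?I zs s'" and s4: "s' 4 = PAIR (enc_entry x) (enc_list enc_entry xs')"
    have s1: "s' 1 = enc_list enc_entry L" using I assms(1) by simp
    show "runs ?c s' (t_leaf M + 30) (\<lambda>s'. s' 4 = PAIR (enc_entry x) (enc_list enc_entry xs') \<and>
      ?I (zs @ [x]) (s'(4 := enc_list enc_entry xs')))"
    proof (rule runs_le[OF runs_Cond[OF runs_Skip runs_Seq[OF runs_leaf_com[OF s1 s4 assms(2)]]]])
      assume "eval_expr (Tl (Tl (Hd (Var 4)))) s' \<noteq> NIL"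
      then have "\<not> ready L x" using s4 by (simp add: ready_def)
      then show "s' 4 = PAIR (enc_entry x) (enc_list enc_entry xs') \<and>
          ?I (zs @ [x]) (s'(4 := enc_list enc_entry xs'))"
        using I s4 by auto
    next
      fix s'' assume a: "eval_expr (Tl (Tl (Hd (Var 4)))) s' = NIL"
        and leaf: "s'' 8 \<noteq> NIL \<longleftrightarrow> tgt x \<notin> src ` set L"
        and frame: "\<And>v. v \<notin> {5, 8, 9, 10, 11} \<Longrightarrow> s'' v = s' v"
      have r: "ready L x \<longleftrightarrow> s'' 8 \<noteq> NIL" using a s4 leaf by (auto simp: ready_def)
      have eqs: "s'' 1 = s' 1" "s'' 4 = s' 4" "s'' 7 = s' 7" using frame by simp_all
      show "runs (Cond (Var 8) (Assign 7 (Hd (Var 4))) Skip) s'' (1 + 1 + (1 + expr_time (Hd (Var 4))) + 1)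
        (\<lambda>s'. s' 4 = PAIR (enc_entry x) (enc_list enc_entry xs') \<and>
          ?I (zs @ [x]) (s'(4 := enc_list enc_entry xs')))"
        apply (rule runs_le)
         apply (rule runs_Cond; rule wp)
        using I s4 r eqs by auto
    qed simp
  qed (use assms(1,2) in \<open>auto simp: bounded_def\<close>)
  show "runs pick_com s (t_pick M) (\<lambda>s'. picked L (s' 7))"
    unfolding pick_com_def
    apply (rule runs_le)
     apply (rule wp)+
     apply (use assms(1) in simp)
     apply (rule runs_conseq[OF loop])
     apply (auto simp add: t_pick_def picked_def algebra_simps)
    done
qed (use Q in auto)

text \<open>Variable \<open>8\<close> records whether a remaining entry ends in the source of the
  removed edge. If none does, that source is the root, whose counter is variable
  \<open>2\<close>.\<close>

definition remove_com :: com where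
  "remove_com = Seq (Assign 6 NILC) (Seq (Assign 8 NILC) (Seq (Assign 5 (Var 1)) (Seq (foreach 5
     (Seq (Assign 9 (Tl (Hd (Hd (Var 5))))) (Seq (Assign 10 (Tl (Hd (Var 7)))) (Seq eq_com
       (Cond (Var 11) Skip
         (Seq (Assign 9 (Tl (Hd (Hd (Var 5))))) (Seq (Assign 10 (Hd (Hd (Var 7)))) (Seq eq_com
           (Cond (Var 11)
             (Seq (Assign 8 TRUEC)
               (Assign 6 (ECons (ECons (Hd (Hd (Var 5))) (ECons NILC (Tl (Hd (Var 5))))) (Var 6))))
             (Assign 6 (ECons (Hd (Var 5)) (Var 6))))))))))))
     (Seq (Assign 1 (Var 6)) (Cond (Var 8) Skip (Assign 2 (ECons NILC (Var 2))))))))"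

definition t_remove :: "nat \<Rightarrow> nat" where "t_remove M = M * (2 * t_eq M + 90) + 50"

lemma remove_leaf_snoc:
  "remove_leaf e (zs @ [x]) = remove_leaf e zs @
     (if tgt x = snd e then [] else [(fst x, if tgt x = fst e then Suc (snd x) else snd x)])"
  by (simp add: remove_leaf_def)

text \<open>\<open>src e \<noteq> tgt e\<close> matters for the flag: entries ending in
  \<open>tgt e\<close> are dropped before their target is compared with
  \<open>src e\<close>.\<close>

lemma runs_remove_com:
  assumes "s 1 = enc_list enc_entry L" "s 7 = enc_entry e" "s 2 = enc_unary b" "bounded M L" "src e \<noteq> tgt e"
    and Q: "\<And>s'. s' 1 = enc_list enc_entry (rev (remove_leaf (fst e) L)) \<Longrightarrow>
      s' 2 = enc_unary (if src e \<in> tgt ` set L then b else Suc b) \<Longrightarrow> s' 3 = s 3 \<Longrightarrow> Q s'"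
  shows "runs remove_com s (t_remove M) Q"
proof -
  let ?s = "s(6 := NIL, 8 := NIL, 5 := enc_list enc_entry L)"
  let ?I = "\<lambda>zs s'. s' 7 = s 7 \<and> s' 2 = s 2 \<and> s' 3 = s 3 \<and>
    s' 6 = enc_list enc_entry (rev (remove_leaf (fst e) zs)) \<and> (s' 8 \<noteq> NIL \<longleftrightarrow> src e \<in> tgt ` set zs)"
  let ?c2 = "Cond (Var 11)
             (Seq (Assign 8 TRUEC)
               (Assign 6 (ECons (ECons (Hd (Hd (Var 5))) (ECons NILC (Tl (Hd (Var 5))))) (Var 6))))
             (Assign 6 (ECons (Hd (Var 5)) (Var 6)))"
  let ?c1 = "Cond (Var 11) Skip
         (Seq (Assign 9 (Tl (Hd (Hd (Var 5))))) (Seq (Assign 10 (Hd (Hd (Var 7)))) (Seq eq_com ?c2)))"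
  let ?c = "Seq (Assign 9 (Tl (Hd (Hd (Var 5))))) (Seq (Assign 10 (Tl (Hd (Var 7)))) (Seq eq_com ?c1))"
  have loop: "runs (foreach 5 ?c) ?s (M * (2 * t_eq M + 80 + 6) + 2) (?I L)"
  proof (rule runs_foreach[where f = enc_entry and I = ?I and xs = L])
    fix zs x xs' and s' :: store
    assume L: "L = zs @ x # xs'" and I: "?I zs s'" and s5: "s' 5 = PAIR (enc_entry x) (enc_list enc_entry xs')"
    have x: "length (tgt x) \<le> M" using L assms(4) by (auto simp: bounded_def)
    let ?Q = "\<lambda>s'. s' 5 = PAIR (enc_entry x) (enc_list enc_entry xs') \<and> ?I (zs @ [x]) (s'(5 := enc_list enc_entry xs'))"
    have c2: "runs ?c2 s'' 30 ?Q"
      if "s'' 11 \<noteq> NIL \<longleftrightarrow> tgt x = src e" "tgt x \<noteq> tgt e"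
        "s'' 7 = s' 7" "s'' 2 = s' 2" "s'' 3 = s' 3" "s'' 6 = s' 6" "s'' 8 = s' 8" "s'' 5 = s' 5" for s''
      apply (rule runs_le)
       apply (rule runs_Cond)
        apply (rule wp)+
        apply (use that I s5 in \<open>auto simp: remove_leaf_snoc enc_entry_def\<close>)[1]
       apply (rule wp)+
       apply (use that I s5 in \<open>auto simp: remove_leaf_snoc\<close>)[1]
      apply simp
      done
    have c1: "runs ?c1 s'' (t_eq M + 50) ?Q"
      if "s'' 11 \<noteq> NIL \<longleftrightarrow> tgt x = tgt e"
        "s'' 7 = s' 7" "s'' 2 = s' 2" "s'' 3 = s' 3" "s'' 6 = s' 6" "s'' 8 = s' 8" "s'' 5 = s' 5" for s''
      apply (rule runs_le)
       apply (rule runs_Cond)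
        apply (rule wp)
        apply (use that I s5 assms(5) in \<open>auto simp: remove_leaf_snoc\<close>)[1]
       apply (rule wp)+
       apply (rule runs_eq_com[where x = "tgt x" and y = "src e" and M = M])
          apply (use that I s5 assms(2) x in simp_all)[3]
       apply (rule c2)
              apply (use that in simp_all)
      done
    show "runs ?c s' (2 * t_eq M + 80) ?Q"
      apply (rule runs_le)
       apply (rule wp)+
       apply (rule runs_eq_com[where x = "tgt x" and y = "tgt e" and M = M])
          apply (use I s5 assms(2) x in simp_all)[3]
       apply (rule c1)
             apply simp_all
      done
  qed (use assms(1-4) in \<open>auto simp: bounded_def remove_leaf_def\<close>)
  show ?thesis
    unfolding remove_com_def
    apply (rule runs_le)
     apply (rule wp)+
     apply (use assms(1) in simp)
     apply (rule runs_conseq[OF loop])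
     apply (rule wp)+
      apply (rule Q; use assms(3) in simp)
     apply (rule wp)
     apply (rule Q; use assms(3) in simp)
    apply (simp add: t_remove_def algebra_simps)
    done
qed

text \<open>\<open>Tl\<close> leaves \<open>NIL\<close> unchanged, which is the truncated decrement
  of a unary counter.\<close>

definition level_com :: com where
  "level_com = Seq (Assign 6 NILC) (Seq (Assign 5 (Var 1)) (Seq (foreach 5
     (Assign 6 (ECons (ECons (Hd (Hd (Var 5))) (Tl (Tl (Hd (Var 5))))) (Var 6))))
     (Seq (Assign 1 (Var 6)) (Seq (Assign 2 (Tl (Var 2))) (Assign 3 (ECons NILC (Var 3)))))))"

definition t_level :: "nat \<Rightarrow> nat" where "t_level M = M * 20 + 40"

lemma runs_level_com:
  assumes "s 1 = enc_list enc_entry L" "s 2 = enc_unary b" "s 3 = enc_unary k" "length L \<le> M"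
    and Q: "\<And>s'. s' 1 = enc_list enc_entry (rev (next_level L)) \<Longrightarrow>
      s' 2 = enc_unary (b - 1) \<Longrightarrow> s' 3 = enc_unary (Suc k) \<Longrightarrow> Q s'"
  shows "runs level_com s (t_level M) Q"
proof -
  let ?s = "s(6 := NIL, 5 := enc_list enc_entry L)"
  let ?I = "\<lambda>zs s'. s' 2 = s 2 \<and> s' 3 = s 3 \<and> s' 6 = enc_list enc_entry (rev (next_level zs))"
  let ?c = "Assign 6 (ECons (ECons (Hd (Hd (Var 5))) (Tl (Tl (Hd (Var 5))))) (Var 6))"
  have loop: "runs (foreach 5 ?c) ?s (M * (1 + expr_time (ECons (ECons (Hd (Hd (Var 5))) (Tl (Tl (Hd (Var 5))))) (Var 6)) + 6) + 2) (?I L)"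
  proof (rule runs_foreach[where f = enc_entry and I = ?I and xs = L])
    fix zs x xs' and s' :: store
    assume "?I zs s'" "s' 5 = PAIR (enc_entry x) (enc_list enc_entry xs')"
    then show "runs ?c s' (1 + expr_time (ECons (ECons (Hd (Hd (Var 5))) (Tl (Tl (Hd (Var 5))))) (Var 6)))
        (\<lambda>s'. s' 5 = PAIR (enc_entry x) (enc_list enc_entry xs') \<and>
          ?I (zs @ [x]) (s'(5 := enc_list enc_entry xs')))"
      by (intro runs_Assign) (auto simp: next_level_def enc_entry_def)
  qed (use assms(1,4) in \<open>auto simp: next_level_def\<close>)
  show ?thesis
    unfolding level_com_def
    apply (rule runs_le)
     apply (rule wp)+
     apply (use assms(1) in simp)
     apply (rule runs_conseq[OF loop])
     apply (rule wp)+
     apply (rule Q; use assms(2,3) in simp)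
    apply (simp add: t_level_def)
    done
qed

definition init_com :: com where
  "init_com = Seq (Assign 6 NILC) (Seq (Assign 5 (Tl (Var 0)))
     (Seq (foreach 5 (Assign 6 (ECons (ECons (Hd (Var 5)) TRUEC) (Var 6))))
     (Seq (Assign 1 (Var 6)) (Seq (Assign 2 TRUEC) (Assign 3 NILC)))))"

definition t_init :: "nat \<Rightarrow> nat" where "t_init M = M * 20 + 40"

lemma runs_init_com:
  assumes "s 0 = PAIR d (enc_list enc_edge es)" "length es \<le> M"
    and Q: "\<And>s'. s' 1 = enc_list enc_entry (rev (map (\<lambda>e. (e, 1)) es)) \<Longrightarrow>
      s' 2 = enc_unary 1 \<Longrightarrow> s' 3 = enc_unary 0 \<Longrightarrow> Q s'"
  shows "runs init_com s (t_init M) Q"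
proof -
  let ?s = "s(6 := NIL, 5 := enc_list enc_edge es)"
  let ?I = "\<lambda>zs s'. s' 6 = enc_list enc_entry (rev (map (\<lambda>e. (e, 1)) zs))"
  let ?e = "ECons (ECons (Hd (Var 5)) TRUEC) (Var 6)"
  have loop: "runs (foreach 5 (Assign 6 ?e)) ?s (M * (1 + expr_time ?e + 6) + 2) (?I es)"
  proof (rule runs_foreach[where f = enc_edge and I = ?I and xs = es])
    fix zs x xs' and s' :: store
    assume "?I zs s'" "s' 5 = PAIR (enc_edge x) (enc_list enc_edge xs')"
    then show "runs (Assign 6 ?e) s' (1 + expr_time ?e)
        (\<lambda>s'. s' 5 = PAIR (enc_edge x) (enc_list enc_edge xs') \<and>
          ?I (zs @ [x]) (s'(5 := enc_list enc_edge xs')))"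
      by (intro runs_Assign) (auto simp: enc_entry_def)
  qed (use assms(1,2) in auto)
  show ?thesis
    unfolding init_com_def
    apply (rule runs_le)
     apply (rule wp)+
     apply (use assms(1) in simp)
     apply (rule runs_conseq[OF loop])
     apply (rule wp)+
     apply (rule Q; simp)
    apply (simp add: t_init_def)
    done
qed

text \<open>In the end the counter of the root is its width plus 1 minus the level, so
  \<open>b - 1\<close> has to be added to the level.\<close>

definition final_com :: com where
  "final_com = Seq (Assign 4 (Tl (Var 2)))
     (Seq (foreach 4 (Assign 3 (ECons NILC (Var 3)))) (Assign 0 (Var 3)))"

definition t_final :: "nat \<Rightarrow> nat" where "t_final M = M * 20 + 40"

lemma runs_final_com:
  assumes "s 2 = enc_unary b" "s 3 = enc_unary k" "b \<le> M"
  shows "runs final_com s (t_final M) (\<lambda>s'. s' 0 = enc_unary (k + (b - 1)))"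
proof -
  let ?s = "s(4 := enc_unary (b - 1))"
  let ?I = "\<lambda>zs s'. s' 3 = enc_unary (k + length zs)"
  let ?e = "ECons NILC (Var 3)"
  have loop: "runs (foreach 4 (Assign 3 ?e)) ?s (M * (1 + expr_time ?e + 6) + 2) (?I (replicate (b - 1) ()))"
  proof (rule runs_foreach[where f = "\<lambda>_. NIL" and I = ?I and xs = "replicate (b - 1) ()"])
    fix zs :: "unit list" and x xs' and s' :: store
    assume "?I zs s'" "s' 4 = PAIR NIL (enc_list (\<lambda>_. NIL) xs')"
    then show "runs (Assign 3 ?e) s' (1 + expr_time ?e)
        (\<lambda>s'. s' 4 = PAIR NIL (enc_list (\<lambda>_. NIL) xs') \<and>
          ?I (zs @ [x]) (s'(4 := enc_list (\<lambda>_. NIL) xs')))"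
      by (intro runs_Assign) auto
  qed (use assms in \<open>auto simp: enc_unary_def\<close>)
  show ?thesis
    unfolding final_com_def
    apply (rule runs_le)
     apply (rule wp)+
     apply (simp add: assms(1) del: One_nat_def)
     apply (rule runs_conseq[OF loop])
     apply (rule wp)
     apply simp
    apply (simp add: t_final_def)
    done
qed

section \<open>The main loop and its running time\<close>

definition sweep_com :: com where
  "sweep_com = While (Var 1) (Seq pick_com (Cond (Var 7) remove_com level_com))"

definition t_sweep :: "nat \<Rightarrow> nat" where
  "t_sweep M = Suc M * (t_pick M + t_remove M + t_level M + 20)"

text \<open>A removal may raise \<open>b\<close> by one but lowers the potential by at least one, so
  \<open>b + potential L\<close> never grows. The single bound \<open>M\<close> on it limits the
  number of rounds, the length of the list and the final \<open>b\<close>.\<close>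

lemma runs_sweep_com:
  fixes V :: "word set"
  assumes T: "rooted_at V E r"
    and M: "\<And>p v. (p, v) \<in> E \<Longrightarrow> length p \<le> M \<and> length v \<le> M"
    and inv: "sweep_inv V E r L b k" "b + potential L \<le> M"
    and s: "s 1 = enc_list enc_entry L" "s 2 = enc_unary b" "s 3 = enc_unary k"
  shows "runs sweep_com s (t_sweep M)
    (\<lambda>s'. \<exists>b k. s' 2 = enc_unary b \<and> s' 3 = enc_unary k \<and> b \<le> M \<and> k + (b - 1) = dcw V E)"
proof -
  define I where "I n s \<longleftrightarrow> (\<exists>L b k. s 1 = enc_list enc_entry L \<and> s 2 = enc_unary b \<and> s 3 = enc_unary k \<and>
     sweep_inv V E r L b k \<and> b + potential L \<le> M \<and> n = potential L)" for n and s :: store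
  let ?B = "t_pick M + t_remove M + t_level M + 10"
  have step: "runs (Seq pick_com (Cond (Var 7) remove_com level_com)) s ?B (\<lambda>s'. \<exists>m < n. I m s')"
    if I: "I n s" and ne: "eval_expr (Var 1) s \<noteq> NIL" for n s
  proof -
    obtain L b k where L: "s 1 = enc_list enc_entry L" "s 2 = enc_unary b" "s 3 = enc_unary k"
      "sweep_inv V E r L b k" "b + potential L \<le> M" "n = potential L"
      using I unfolding I_def by blast
    have "L \<noteq> []" using ne L(1) by auto
    have len: "length L \<le> M" using L(5) by (simp add: potential_def)
    have edge: "(src e, tgt e) \<in> E" if "e \<in> set L" for e
      using sweep_invD(2)[OF L(4)] that by auto
    have bnd: "bounded M L" unfolding bounded_def using len M[OF edge] by blast
    have rest: "runs (Cond (Var 7) remove_com level_com) s' (1 + expr_time (Var 7) + t_remove M + t_level M)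
        (\<lambda>s'. \<exists>m < n. I m s')"
      if pick: "picked L (s' 7)" and frame: "\<And>v. v \<notin> {4, 5, 7, 8, 9, 10, 11} \<Longrightarrow> s' v = s v" for s'
    proof (rule runs_Cond)
      have s': "s' 1 = enc_list enc_entry L" "s' 2 = enc_unary b" "s' 3 = enc_unary k"
        using frame L(1-3) by simp_all
      {
        assume "eval_expr (Var 7) s' \<noteq> NIL"
        then obtain e where e: "e \<in> set L" "ready L e" "s' 7 = enc_entry e"
          using pick by (auto simp: picked_def)
        have "src e \<noteq> tgt e" using rooted_at_irrefl[OF T] edge[OF e(1)] by metis
        note step = sweep_inv_remove_leaf[OF T L(4) e(1,2)]
        show "runs remove_com s' (t_remove M) (\<lambda>s'. \<exists>m < n. I m s')"
        proof (rule runs_remove_com[OF s'(1) e(3) s'(2) bnd \<open>src e \<noteq> tgt e\<close>])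
          fix s'' :: store assume s'': "s'' 1 = enc_list enc_entry (rev (remove_leaf (fst e) L))"
            "s'' 2 = enc_unary (if src e \<in> tgt ` set L then b else Suc b)" "s'' 3 = s' 3"
          have pot: "potential (rev (remove_leaf (fst e) L)) = potential (remove_leaf (fst e) L)"
            by (simp add: potential_def rev_map[symmetric])
          have "I (potential (remove_leaf (fst e) L)) s''"
            unfolding I_def
          proof (intro exI conjI)
            show "s'' 3 = enc_unary k" using s''(3) s'(3) by simp
            show "sweep_inv V E r (rev (remove_leaf (fst e) L)) (if src e \<in> tgt ` set L then b else Suc b) k"
              using step(1) by (simp add: sweep_inv_rev)
            show "(if src e \<in> tgt ` set L then b else Suc b) + potential (rev (remove_leaf (fst e) L)) \<le> M"
              using step(2) L(5) pot by simp
          qed (use s'' pot in simp_all)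
          then show "\<exists>m < n. I m s''" using step(2) L(6) by blast
        qed
      next
        assume "eval_expr (Var 7) s' = NIL"
        then have none: "\<not> ready L e" if "e \<in> set L" for e
          using pick that by (auto simp: picked_def enc_entry_def)
        note step = sweep_inv_next_level[OF T L(4) \<open>L \<noteq> []\<close> none]
        show "runs level_com s' (t_level M) (\<lambda>s'. \<exists>m < n. I m s')"
        proof (rule runs_level_com[OF s' len])
          fix s'' :: store assume s'': "s'' 1 = enc_list enc_entry (rev (next_level L))"
            "s'' 2 = enc_unary (b - 1)" "s'' 3 = enc_unary (Suc k)"
          have pot: "potential (rev (next_level L)) = potential (next_level L)"
            by (simp add: potential_def rev_map[symmetric])
          have "I (potential (next_level L)) s''"
            unfolding I_def
          proof (intro exI conjI)
            show "sweep_inv V E r (rev (next_level L)) (b - 1) (Suc k)"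
              using step(1) by (simp add: sweep_inv_rev)
            show "b - 1 + potential (rev (next_level L)) \<le> M"
              using step(2) L(5) pot by simp
          qed (use s'' pot in simp_all)
          then show "\<exists>m < n. I m s''" using step(2) L(6) by blast
        qed
      }
    qed
    show ?thesis
      apply (rule runs_le)
       apply (rule runs_Seq)
       apply (rule runs_pick_com[where s = s and L = L and M = M, OF L(1) bnd])
       apply (erule rest)
       apply simp_all
      done
  qed
  have "I (potential L) s" unfolding I_def using inv s by blast
  then have loop: "runs sweep_com s (Suc (potential L) * (1 + expr_time (Var 1) + ?B))
      (\<lambda>s'. \<exists>n. I n s' \<and> eval_expr (Var 1) s' = NIL)"
    unfolding sweep_com_def by (rule runs_While_measure) (rule step)
  have "Suc (potential L) * (1 + expr_time (Var 1) + ?B) \<le> t_sweep M"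
    unfolding t_sweep_def using inv(2) by (intro mult_le_mono) auto
  then show ?thesis
  proof (rule runs_le[OF runs_conseq[OF loop], rotated])
    fix s' assume "\<exists>n. I n s' \<and> eval_expr (Var 1) s' = NIL"
    then obtain L b k where L: "s' 1 = enc_list enc_entry L" "s' 2 = enc_unary b" "s' 3 = enc_unary k"
      "sweep_inv V E r L b k" "b + potential L \<le> M" "s' 1 = NIL"
      unfolding I_def by auto
    then have "L = []" by simp
    then have "k + (b - 1) = dcw V E" using sweep_inv_final[OF T] L(4) by simp
    then show "\<exists>b k. s' 2 = enc_unary b \<and> s' 3 = enc_unary k \<and> b \<le> M \<and> k + (b - 1) = dcw V E"
      using L by (intro exI[of _ b] exI[of _ k]) simp
  qed
qed

definition dcw_com :: com where
  "dcw_com = Seq init_com (Seq sweep_com final_com)"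

definition t_dcw :: "nat \<Rightarrow> nat" where
  "t_dcw M = t_init M + t_sweep M + t_final M + 2"

text \<open>The bound \<open>3 * length es + 1\<close> is the initial
  \<open>b + potential L\<close>: each edge has counter 1 and weight 2, and the counter of the root
  is 1.\<close>

lemma runs_dcw_com:
  fixes V :: "word set"
  assumes T: "rooted_at V (set es) r" and "distinct es"
    and M: "\<And>p v. (p, v) \<in> set es \<Longrightarrow> length p \<le> M \<and> length v \<le> M" "3 * length es + 1 \<le> M"
    and s: "s 0 = PAIR d (enc_list enc_edge es)"
  shows "runs dcw_com s (t_dcw M) (\<lambda>s'. s' 0 = enc_unary (dcw V (set es)))"
  unfolding dcw_com_def
proof (rule runs_le[OF runs_Seq[OF runs_init_com[where d = d and es = es and s = s and M = M, OF s]]])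
  let ?L = "rev (map (\<lambda>e. (e, 1 :: nat)) es)"
  have inv: "sweep_inv V (set es) r ?L 1 0"
    using sweep_inv_init[OF T assms(2)] by (simp add: sweep_inv_rev)
  have "sum_list (map snd ?L) = length es" by (induction es) auto
  then have pot: "1 + potential ?L \<le> M" using M(2) by (simp add: potential_def)
  fix s' :: store assume s': "s' 1 = enc_list enc_entry ?L" "s' 2 = enc_unary 1" "s' 3 = enc_unary 0"
  show "runs (Seq sweep_com final_com) s' (1 + t_sweep M + t_final M) (\<lambda>s'. s' 0 = enc_unary (dcw V (set es)))"
  proof (rule runs_Seq, rule runs_conseq[OF runs_sweep_com[OF T M(1) inv pot s']])
    fix s'' :: store
    assume "\<exists>b k. s'' 2 = enc_unary b \<and> s'' 3 = enc_unary k \<and> b \<le> M \<and> k + (b - 1) = dcw V (set es)"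
    then show "runs final_com s'' (t_final M) (\<lambda>s'. s' 0 = enc_unary (dcw V (set es)))"
      using runs_final_com by metis
  qed
qed (use M(2) in \<open>auto simp: t_dcw_def\<close>)

section \<open>A polynomial in the size of the encoding\<close>

lemma length_le_size_enc_list: "length xs \<le> size (enc_list f xs)"
  by (induction xs) auto

lemma size_le_size_enc_list: "x \<in> set xs \<Longrightarrow> size (f x) \<le> size (enc_list f xs)"
  by (induction xs) auto

lemma dcw_polytime:
  "polytime_computable tree_instances enc_instance enc_unary (\<lambda>(vs, es). dcw (set vs) (set es))"
proof -
  \<comment> \<open>The polynomial \<open>1 + 3 * n\<close>. Since \<open>n\<close> counts the pairs
    of the input, its value dominates \<open>3 * length es + 1\<close> and the length of every
    vertex name in \<open>es\<close>. The polynomials below mirror the time bounds, with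
    \<open>q_lin\<close> for the three linear ones.\<close>
  let ?M = "[:1, 3:] :: nat poly"
  define q_eq where "q_eq = [:40:] * ?M + [:20:]"
  define q_leaf where "q_leaf = ?M * (q_eq + [:40:]) + [:20:]"
  define q_pick where "q_pick = ?M * (q_leaf + [:40:]) + [:20:]"
  define q_remove where "q_remove = ?M * ([:2:] * q_eq + [:90:]) + [:50:]"
  define q_lin where "q_lin = ?M * [:20:] + [:40:]"
  define q where "q = q_lin + (?M + [:1:]) * (q_pick + q_remove + q_lin + [:20:]) + q_lin + [:2:]"
  have q: "poly q n = t_dcw (1 + 3 * n)" for n
    unfolding q_def q_lin_def q_remove_def q_pick_def q_leaf_def q_eq_def
      t_dcw_def t_init_def t_final_def t_sweep_def t_pick_def t_leaf_def t_remove_def t_level_def t_eq_def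
    by (simp add: algebra_simps)
  have "computes_within dcw_com (enc_instance (vs, es)) (enc_unary (dcw (set vs) (set es)))
      (poly q (size (enc_instance (vs, es))))" if inst: "(vs, es) \<in> tree_instances" for vs es
  proof -
    let ?n = "size (enc_instance (vs, es))"
    obtain r where T: "rooted_at (set vs) (set es) r" and "distinct es"
      using inst by (auto simp: tree_instances_def rooted_tree_def)
    have n: "size (enc_list enc_edge es) \<le> ?n" by (simp add: enc_instance_def)
    have words: "length p \<le> 1 + 3 * ?n \<and> length v \<le> 1 + 3 * ?n" if "(p, v) \<in> set es" for p v
    proof -
      have "size (enc_edge (p, v)) \<le> ?n" using size_le_size_enc_list[OF that, of enc_edge] n by linarith
      moreover have "length p \<le> size (enc_word p)" "length v \<le> size (enc_word v)"
        by (simp_all add: enc_word_def length_le_size_enc_list)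
      ultimately show ?thesis by (simp add: enc_edge_def)
    qed
    have "3 * length es + 1 \<le> 1 + 3 * ?n" using length_le_size_enc_list[of es enc_edge] n by linarith
    then have "runs dcw_com ((\<lambda>_. NIL)(0 := enc_instance (vs, es))) (t_dcw (1 + 3 * ?n))
        (\<lambda>s'. s' 0 = enc_unary (dcw (set vs) (set es)))"
      by (intro runs_dcw_com[OF T \<open>distinct es\<close> words]) (simp_all add: enc_instance_def)
    then show ?thesis unfolding computes_within_def runs_def q by blast
  qed
  then show ?thesis unfolding polytime_computable_def
    by (intro exI[of _ dcw_com] exI[of _ q]) auto
qed

theorem theorem1:
  shows "(\<forall>(V :: 'a set) E. rooted_tree V E \<longrightarrow>
            (\<exists>S. standard_serialization V E S) \<and>
            (\<forall>S. standard_serialization V E S \<longrightarrow>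
                 serialization V E S \<and> dcw V E = dcw_ser V E S))
       \<and> polytime_computable tree_instances enc_instance enc_unary
            (\<lambda>(vs, es). dcw (set vs) (set es))"
proof (intro conjI allI impI)
  fix V :: "'a set" and E
  assume "rooted_tree V E"
  then show "\<exists>S. standard_serialization V E S"
    using standard_serialization_exists by (auto simp: rooted_tree_def)
qed (use standard_serialization_optimal dcw_polytime in auto)

end
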